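(* The border support rank of $\langle 2,2,2\rangle$ over $\mathbb{C}$ is $7$. That is, every tensor $t\in \mathbb{C}^{2\times 2}\otimes\mathbb{C}^{2\times 2}\otimes\mathbb{C}^{2\times 2}$ with the same support as $\langle 2,2,2\rangle$ has border rank at least $7$, and some such tensor has border rank exactly $7$.
   Context: Let $e_{ij}$ ($i,j\in\{1,2\}$) be the standard basis of $\mathbb{C}^{2\times 2}$ and $\langle 2,2,2\rangle=\sum_{i,j,k\in\{1,2\}} e_{ij}\otimes e_{jk}\otimes e_{ki}$. The support of a tensor (with respect to the basis $\{e_{ab}\otimes e_{cd}\otimes e_{ef}\}$) is the set of basis elements with nonzero coefficient. The border rank of a tensor $t\in V_1\otimes V_2\otimes V_3$ over $\mathbb{C}$ is the smallest $r$ such that $t$ lies in the Zariski closure of the set of tensors of tensor rank at most $r$. The border support rank of $t$ is the minimal border rank of a complex tensor with the same support as $t$. *)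

theory Defs
  imports Complex_Main "HOL-Library.Numeral_Type"
begin

text \<open>Matrix entry indices (i,j) with i,j in {1,2}, represented by the two-element type 2.
  A tensor in C^(2x2) (x) C^(2x2) (x) C^(2x2) is given by its coordinates with respect to the
  basis e_ab (x) e_cd (x) e_ef.\<close>

type_synonym mi = "2 \<times> 2"
type_synonym tensor = "mi \<Rightarrow> mi \<Rightarrow> mi \<Rightarrow> complex"

definition mamu222 :: tensor where
  "mamu222 = (\<lambda>(a,b) (c,d) (e,f). if b = c \<and> d = e \<and> f = a then 1 else 0)"

definition rank_le :: "tensor \<Rightarrow> nat \<Rightarrow> bool" where
  "rank_le t r \<longleftrightarrow> (\<exists>u v w :: nat \<Rightarrow> mi \<Rightarrow> complex.
      t = (\<lambda>x y z. \<Sum>l<r. u l x * v l y * w l z))"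

definition poly_fun :: "(tensor \<Rightarrow> complex) \<Rightarrow> bool" where
  "poly_fun p \<longleftrightarrow> (\<exists>(E :: (mi \<times> mi \<times> mi \<Rightarrow> nat) set) (c :: (mi \<times> mi \<times> mi \<Rightarrow> nat) \<Rightarrow> complex).
      finite E \<and>
      p = (\<lambda>t. \<Sum>e\<in>E. c e * (\<Prod>k\<in>UNIV. (case k of (x,y,z) \<Rightarrow> t x y z) ^ e k)))"

definition zariski_closure :: "tensor set \<Rightarrow> tensor set" where
  "zariski_closure S = {t. \<forall>p. poly_fun p \<longrightarrow> (\<forall>s\<in>S. p s = 0) \<longrightarrow> p t = 0}"

definition border_rank :: "tensor \<Rightarrow> nat" where
  "border_rank t = (LEAST r. t \<in> zariski_closure {s. rank_le s r})"

definition tsupport :: "tensor \<Rightarrow> (mi \<times> mi \<times> mi) set" where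
  "tsupport t = {(x,y,z). t x y z \<noteq> 0}"

end

theory Submission
  imports Defs "HOL-Computational_Algebra.Fundamental_Theorem_Algebra"
begin

text \<open>
  Border apolarity. Let \<open>s = \<Sum>\<^sub>l u\<^sub>l \<otimes> v\<^sub>l \<otimes> w\<^sub>l\<close> have rank at most six, with the six \<open>u\<^sub>l \<otimes> v\<^sub>l\<close> independent
  after padding, and let \<open>F\<close> be their span. Then \<open>F\<close> contains the slices of \<open>s\<close>, has dimension six,
  and \<open>A \<otimes> F \<inter> S\<^sup>2A \<otimes> B\<close> and \<open>F \<otimes> B \<inter> A \<otimes> S\<^sup>2B\<close> have dimension at least six, as they contain the
  \<open>u\<^sub>l \<otimes> u\<^sub>l \<otimes> v\<^sub>l\<close> and the \<open>u\<^sub>l \<otimes> v\<^sub>l \<otimes> v\<^sub>l\<close>. These properties persist in the limit. Limits along the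
  Zariski closure are taken with a place: the evaluation of polynomials at the limit tensor extends
  to a maximal partial homomorphism on the functions on the parameter space of the tensors of rank
  at most six, and for a nowhere vanishing function \<open>f\<close> its domain contains \<open>f\<close> or \<open>1/f\<close>, so that
  projective points specialise.

  A tensor with the support of \<open>\<langle>2,2,2\<rangle>\<close> is homogeneous for a five-dimensional torus. Passing to the
  parts of lowest weight under a generic one-parameter subgroup, \<open>F\<close> may be replaced by the span of
  the four slices and two further weight vectors. For each such space five coordinates already
  determine one of the two spaces of symmetric tensors, a contradiction.
\<close>

section \<open>Places\<close>

text \<open>A partial homomorphism of complex algebras, given by its graph; the last clause makes the
  graph single-valued.\<close>

definition partial_hom :: "(('x \<Rightarrow> complex) \<times> complex) set \<Rightarrow> bool" where
  "partial_hom H \<longleftrightarrow>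
     (\<forall>c. (\<lambda>_. c, c) \<in> H) \<and>
     (\<forall>f a g b. (f, a) \<in> H \<longrightarrow> (g, b) \<in> H \<longrightarrow>
        (\<lambda>x. f x + g x, a + b) \<in> H \<and> (\<lambda>x. f x * g x, a * b) \<in> H) \<and>
     (\<forall>a. (\<lambda>_. 0, a) \<in> H \<longrightarrow> a = 0)"

lemma partial_homI:
  assumes "\<And>c. (\<lambda>_. c, c) \<in> H"
    and "\<And>f a g b. (f, a) \<in> H \<Longrightarrow> (g, b) \<in> H \<Longrightarrow> (\<lambda>x. f x + g x, a + b) \<in> H"
    and "\<And>f a g b. (f, a) \<in> H \<Longrightarrow> (g, b) \<in> H \<Longrightarrow> (\<lambda>x. f x * g x, a * b) \<in> H"
    and "\<And>a. (\<lambda>_. 0, a) \<in> H \<Longrightarrow> a = 0"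
  shows "partial_hom H"
  using assms unfolding partial_hom_def by blast

lemma partial_hom_const: "partial_hom H \<Longrightarrow> (\<lambda>_. c, c) \<in> H"
  and partial_hom_add:
    "partial_hom H \<Longrightarrow> (f, a) \<in> H \<Longrightarrow> (g, b) \<in> H \<Longrightarrow> (\<lambda>x. f x + g x, a + b) \<in> H"
  and partial_hom_mult:
    "partial_hom H \<Longrightarrow> (f, a) \<in> H \<Longrightarrow> (g, b) \<in> H \<Longrightarrow> (\<lambda>x. f x * g x, a * b) \<in> H"
  and partial_hom_zero: "partial_hom H \<Longrightarrow> (\<lambda>_. 0, a) \<in> H \<Longrightarrow> a = 0"
  unfolding partial_hom_def by blast+

lemma partial_hom_diff:
  assumes H: "partial_hom H" and "(f, a) \<in> H" "(g, b) \<in> H"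
  shows "(\<lambda>x. f x - g x, a - b) \<in> H"
  using partial_hom_add[OF H assms(2) partial_hom_mult[OF H partial_hom_const[OF H, of "-1"] assms(3)]]
  by simp

lemma partial_hom_unique:
  assumes H: "partial_hom H" and "(f, a) \<in> H" "(f, b) \<in> H"
  shows "a = b"
  using partial_hom_zero[OF H, of "a - b"] partial_hom_diff[OF assms] by simp

lemma partial_hom_sum:
  assumes H: "partial_hom H" and "\<And>i. i \<in> I \<Longrightarrow> (f i, a i) \<in> H"
  shows "(\<lambda>x. \<Sum>i\<in>I. f i x, \<Sum>i\<in>I. a i) \<in> H"
  using assms(2)
proof (induction I rule: infinite_finite_induct)
  case (insert i I)
  then show ?case using partial_hom_add[OF H, of "f i" "a i" "\<lambda>x. \<Sum>i\<in>I. f i x" "\<Sum>i\<in>I. a i"] by simp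
qed (simp_all add: partial_hom_const[OF H])

text \<open>\<open>P\<close> is a polynomial with coefficients in the domain of the homomorphism, seen as a family of
  complex polynomials, and \<open>p\<close> is its image.\<close>

definition poly_rel :: "(('x \<Rightarrow> complex) \<times> complex) set \<Rightarrow> ('x \<Rightarrow> complex poly) \<Rightarrow> complex poly \<Rightarrow> bool" where
  "poly_rel H P p \<longleftrightarrow> (\<exists>N. \<forall>x. degree (P x) \<le> N) \<and> (\<forall>i. (\<lambda>x. coeff (P x) i, coeff p i) \<in> H)"

lemma poly_rel_const: "partial_hom H \<Longrightarrow> poly_rel H (\<lambda>_. q) q"
  unfolding poly_rel_def by (auto intro: partial_hom_const)

lemma poly_rel_of_mem:
  assumes H: "partial_hom H" and "(f, a) \<in> H"
  shows "poly_rel H (\<lambda>x. [:f x:]) [:a:]"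
  unfolding poly_rel_def
proof
  show "\<forall>i. (\<lambda>x. coeff [:f x:] i, coeff [:a:] i) \<in> H"
    using assms partial_hom_const[OF H, of 0] by (auto simp: coeff_pCons split: nat.split)
qed auto

lemma poly_rel_add:
  assumes H: "partial_hom H" and "poly_rel H P p" "poly_rel H Q q"
  shows "poly_rel H (\<lambda>x. P x + Q x) (p + q)"
proof -
  obtain M N where "\<forall>x. degree (P x) \<le> M" "\<forall>x. degree (Q x) \<le> N"
    using assms unfolding poly_rel_def by blast
  then have "\<forall>x. degree (P x + Q x) \<le> max M N"
    by (meson degree_add_le max.coboundedI1 max.coboundedI2)
  then show ?thesis
    using assms partial_hom_add[OF H] unfolding poly_rel_def by auto
qed

lemma poly_rel_mult:
  assumes H: "partial_hom H" and "poly_rel H P p" "poly_rel H Q q"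
  shows "poly_rel H (\<lambda>x. P x * Q x) (p * q)"
proof -
  obtain M N where "\<forall>x. degree (P x) \<le> M" "\<forall>x. degree (Q x) \<le> N"
    using assms unfolding poly_rel_def by blast
  then have "\<forall>x. degree (P x * Q x) \<le> M + N"
    by (meson add_mono degree_mult_le order_trans)
  moreover have "(\<lambda>x. coeff (P x * Q x) i, coeff (p * q) i) \<in> H" for i
    unfolding coeff_mult
    by (intro partial_hom_sum[OF H] partial_hom_mult[OF H])
       (use assms in \<open>auto simp: poly_rel_def\<close>)
  ultimately show ?thesis unfolding poly_rel_def by blast
qed

section \<open>Maximal partial homomorphisms and their valuation property\<close>

definition maximal_hom :: "(('x \<Rightarrow> complex) \<times> complex) set \<Rightarrow> bool" where
  "maximal_hom H \<longleftrightarrow> partial_hom H \<and> (\<forall>K. partial_hom K \<longrightarrow> H \<subseteq> K \<longrightarrow> K = H)"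

text \<open>Zorn's lemma applies because each clause of \<open>partial_hom\<close> involves at most
  two pairs of the graph, and two pairs in the union of a chain already lie in one member.\<close>

lemma maximal_hom_exists:
  assumes "partial_hom H0"
  obtains H where "maximal_hom H" "H0 \<subseteq> H"
proof -
  have "\<exists>M\<in>{H. partial_hom H \<and> H0 \<subseteq> H}. \<forall>K\<in>{H. partial_hom H \<and> H0 \<subseteq> H}. M \<subseteq> K \<longrightarrow> K = M"
  proof (rule subset_Zorn_nonempty)
    show "{H. partial_hom H \<and> H0 \<subseteq> H} \<noteq> {}" using assms by blast
    fix C assume C: "C \<noteq> {}" "subset.chain {H. partial_hom H \<and> H0 \<subseteq> H} C"
    then have mem: "\<And>H. H \<in> C \<Longrightarrow> partial_hom H \<and> H0 \<subseteq> H"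
      and total: "\<And>H K. H \<in> C \<Longrightarrow> K \<in> C \<Longrightarrow> H \<subseteq> K \<or> K \<subseteq> H"
      by (auto simp: subset_chain_def)
    have common: "\<exists>K\<in>C. p \<in> K \<and> q \<in> K" if "p \<in> \<Union>C" "q \<in> \<Union>C" for p q
      using that total by blast
    have "partial_hom (\<Union>C)"
    proof (rule partial_homI)
      show "(\<lambda>_. c, c) \<in> \<Union>C" for c
      proof -
        obtain K where "K \<in> C" "partial_hom K" using C(1) mem by blast
        then show ?thesis using partial_hom_const by blast
      qed
      show "(\<lambda>x. f x + g x, a + b) \<in> \<Union>C" "(\<lambda>x. f x * g x, a * b) \<in> \<Union>C"
        if "(f, a) \<in> \<Union>C" "(g, b) \<in> \<Union>C" for f a g b
      proof -
        obtain K where "K \<in> C" "(f, a) \<in> K" "(g, b) \<in> K" using common[OF \<open>(f, a) \<in> \<Union>C\<close> \<open>(g, b) \<in> \<Union>C\<close>] by blast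
        moreover from \<open>K \<in> C\<close> have "partial_hom K" using mem by blast
        note partial_hom_add[OF this, of f a g b] partial_hom_mult[OF this, of f a g b]
        ultimately show "(\<lambda>x. f x + g x, a + b) \<in> \<Union>C" "(\<lambda>x. f x * g x, a * b) \<in> \<Union>C" by auto
      qed
      show "a = 0" if "(\<lambda>_. 0, a) \<in> \<Union>C" for a using that mem partial_hom_zero by blast
    qed
    then show "\<Union>C \<in> {H. partial_hom H \<and> H0 \<subseteq> H}" using C(1) mem by blast
  qed
  then obtain M where "M \<in> {H. partial_hom H \<and> H0 \<subseteq> H}"
      "\<forall>K\<in>{H. partial_hom H \<and> H0 \<subseteq> H}. M \<subseteq> K \<longrightarrow> K = M" ..
  then show ?thesis by (intro that[of M]) (auto simp: maximal_hom_def)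
qed

text \<open>If no value for \<open>f\<close> extends the homomorphism, the polynomials over the value field that
  arise from relations of \<open>f\<close> form an ideal without a common root, hence the unit ideal.\<close>

lemma no_value_relation:
  assumes max: "maximal_hom H" and f: "\<And>a. (f, a) \<notin> H"
  obtains n b where "(b 0, 1) \<in> H" "\<And>i. i > 0 \<Longrightarrow> (b i, 0) \<in> H"
    "\<And>x. (\<Sum>i\<le>n. b i x * f x ^ i) = 0"
proof -
  have H: "partial_hom H" using max unfolding maximal_hom_def by blast
  define J where "J = {p. \<exists>P. poly_rel H P p \<and> (\<forall>x. poly (P x) (f x) = 0)}"
  have J_mult: "q * p \<in> J" if "p \<in> J" for p q
  proof -
    obtain P where "poly_rel H P p" "\<And>x. poly (P x) (f x) = 0"
      using \<open>p \<in> J\<close> unfolding J_def by blast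
    then show ?thesis
      unfolding J_def by (auto intro!: exI[of _ "\<lambda>x. q * P x"] poly_rel_mult[OF H poly_rel_const[OF H]])
  qed
  have J_add: "p + q \<in> J" if "p \<in> J" "q \<in> J" for p q
  proof -
    obtain P Q where "poly_rel H P p" "poly_rel H Q q"
      "\<And>x. poly (P x) (f x) = 0" "\<And>x. poly (Q x) (f x) = 0"
      using \<open>p \<in> J\<close> \<open>q \<in> J\<close> unfolding J_def by blast
    then show ?thesis
      unfolding J_def by (auto intro!: exI[of _ "\<lambda>x. P x + Q x"] poly_rel_add[OF H])
  qed
  have no_root: "\<exists>p\<in>J. poly p \<alpha> \<noteq> 0" for \<alpha>
  proof (rule ccontr)
    assume contra: "\<not> ?thesis"
    \<comment> \<open>If all of \<open>J\<close> vanished at \<open>\<alpha>\<close>, evaluation at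
      \<open>\<alpha>\<close> would be a well-defined extension of \<open>H\<close> giving
      \<open>f\<close> the value \<open>\<alpha>\<close>, against maximality.\<close>
    define K where "K = {(\<lambda>x. poly (P x) (f x), poly p \<alpha>) | P p. poly_rel H P p}"
    have KI: "(g, c) \<in> K" if "poly_rel H P p" "g = (\<lambda>x. poly (P x) (f x))" "c = poly p \<alpha>" for g c P p
      using that unfolding K_def by blast
    have "partial_hom K"
    proof (rule partial_homI)
      show "(\<lambda>_. c, c) \<in> K" for c
        by (rule KI[OF poly_rel_const[OF H, of "[:c:]"]]) auto
      fix g a h b assume "(g, a) \<in> K" "(h, b) \<in> K"
      then obtain P p Q q where "poly_rel H P p" "g = (\<lambda>x. poly (P x) (f x))" "a = poly p \<alpha>"
        and "poly_rel H Q q" "h = (\<lambda>x. poly (Q x) (f x))" "b = poly q \<alpha>"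
        unfolding K_def by blast
      then show "(\<lambda>x. g x + h x, a + b) \<in> K" "(\<lambda>x. g x * h x, a * b) \<in> K"
        using KI[OF poly_rel_add[OF H, of P p Q q]] KI[OF poly_rel_mult[OF H, of P p Q q]] by simp_all
    next
      fix a assume "(\<lambda>_. 0, a) \<in> K"
      then obtain P p where "poly_rel H P p" "(\<lambda>_. 0) = (\<lambda>x. poly (P x) (f x))" "a = poly p \<alpha>"
        unfolding K_def by blast
      moreover from this have "p \<in> J" unfolding J_def by (auto intro!: exI[of _ P] dest: fun_cong)
      ultimately show "a = 0" using contra by blast
    qed
    moreover have "H \<subseteq> K"
      by (auto intro!: KI[OF poly_rel_of_mem[OF H]])
    moreover have "(f, \<alpha>) \<in> K"
      by (rule KI[OF poly_rel_const[OF H, of "[:0, 1:]"]]) auto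
    ultimately show False using max f unfolding maximal_hom_def by blast
  qed
  have ex: "\<exists>d p. p \<in> J \<and> p \<noteq> 0 \<and> degree p = d"
    using no_root[of 0] by fastforce
  define d where "d = (LEAST d. \<exists>p. p \<in> J \<and> p \<noteq> 0 \<and> degree p = d)"
  obtain p where p: "p \<in> J" "p \<noteq> 0" "degree p = d"
    using LeastI_ex[OF ex] unfolding d_def by blast
  have p_min: "d \<le> degree q" if "q \<in> J" "q \<noteq> 0" for q
    unfolding d_def using that by (auto intro: Least_le)
  \<comment> \<open>The remainder of any \<open>q\<close> in \<open>J\<close> modulo
    \<open>p\<close> lies in \<open>J\<close>, so it is zero by minimality of the degree. A root of
    \<open>p\<close> would therefore be common to all of \<open>J\<close>.\<close>
  have "d = 0"
  proof (rule ccontr)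
    assume "d \<noteq> 0"
    then have "\<not> constant (poly p)" using p(3) by (simp add: constant_degree)
    then obtain \<alpha> where root: "poly p \<alpha> = 0"
      using fundamental_theorem_of_algebra by blast
    obtain q where q: "q \<in> J" "poly q \<alpha> \<noteq> 0" using no_root by blast
    have "q mod p = q + (- (q div p)) * p"
      by (simp add: minus_div_mult_eq_mod[symmetric])
    then have "q mod p \<in> J" using J_add[OF q(1) J_mult[OF p(1)]] by metis
    then have "q mod p = 0"
      using p_min degree_mod_less[OF p(2), of q] p(3) by fastforce
    then have "q = q div p * p" using div_mult_mod_eq[of q p] by simp
    then have "poly q \<alpha> = 0" using root by (metis mult_zero_right poly_mult)
    with q(2) show False ..
  qed
  then obtain c where c: "p = [:c:]" using p(3) degree_eq_zeroE by blast
  then have "c \<noteq> 0" using p(2) by auto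
  then have "[:inverse c:] * p = 1" using c by (simp add: one_pCons)
  then have "1 \<in> J" using J_mult[OF p(1)] by metis
  then obtain P N where P: "poly_rel H P 1" "\<And>x. poly (P x) (f x) = 0" "\<And>x. degree (P x) \<le> N"
    unfolding J_def poly_rel_def by blast
  show ?thesis
  proof (rule that)
    have "(\<lambda>x. coeff (P x) i, coeff 1 i) \<in> H" for i
      using P(1) unfolding poly_rel_def by blast
    note coeffs = this[unfolded coeff_1]
    show "((\<lambda>i x. coeff (P x) i) 0, 1) \<in> H"
      using coeffs[of 0] by simp
    show "((\<lambda>i x. coeff (P x) i) i, 0) \<in> H" if "i > 0" for i
      using coeffs[of i] that by simp
    \<comment> \<open>The uniform degree bound gives one number of coefficients for all
      points.\<close>
    show "(\<Sum>i\<le>N. coeff (P x) i * f x ^ i) = 0" for x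
    proof -
      have "(\<Sum>i\<le>N. coeff (P x) i * f x ^ i) = (\<Sum>i\<le>degree (P x). coeff (P x) i * f x ^ i)"
        using P(3)[of x] by (intro sum.mono_neutral_right) (auto simp: coeff_eq_0)
      then show ?thesis using P(2)[of x] by (simp add: poly_altdef)
    qed
  qed
qed

text \<open>The degree descent in the proof that maximal local rings are valuation rings, arranged so that
  no inverse of the coefficient \<open>d 0\<close> is needed: it may vanish at some points.\<close>

lemma no_two_relations:
  fixes f g :: "'x \<Rightarrow> complex"
  assumes H: "partial_hom H"
    and "\<And>x. f x * g x = 1"
    and "(b 0, 1) \<in> H" "\<And>i. i > 0 \<Longrightarrow> (b i, 0) \<in> H" "\<And>x. (\<Sum>i\<le>n. b i x * f x ^ i) = 0"
    and "(d 0, 1) \<in> H" "\<And>i. i > 0 \<Longrightarrow> (d i, 0) \<in> H" "\<And>x. (\<Sum>i\<le>m. d i x * g x ^ i) = 0"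
  shows False
  using assms(2-)
proof (induction "n + m" arbitrary: n m f g b d rule: less_induct)
  case less
  \<comment> \<open>The roles of \<open>f\<close> and \<open>g\<close> can be exchanged, so the
    relation of larger degree is put first.\<close>
  have step: False
    if le: "m' \<le> n'" and sz: "n' + m' = n + m" and fg: "\<And>x. f' x * g' x = (1::complex)"
      and b: "(b' 0, 1) \<in> H" "\<And>i. i > 0 \<Longrightarrow> (b' i, 0) \<in> H" "\<And>x. (\<Sum>i\<le>n'. b' i x * f' x ^ i) = 0"
      and d: "(d' 0, 1) \<in> H" "\<And>i. i > 0 \<Longrightarrow> (d' i, 0) \<in> H" "\<And>x. (\<Sum>i\<le>m'. d' i x * g' x ^ i) = 0"
    for f' g' b' d' n' m'
  proof (cases n')
    case 0
    then have "b' 0 = (\<lambda>_. 0)" using b(3) by auto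
    then show False using b(1) partial_hom_zero[OF H] by fastforce
  next
    case (Suc k)
    \<comment> \<open>The shorter relation is padded with zero coefficients up to degree
      \<open>n'\<close>.\<close>
    define e where "e i = (if i \<le> m' then d' i else (\<lambda>_. 0))" for i
    have e0: "(e 0, 1) \<in> H" and e1: "\<And>i. i > 0 \<Longrightarrow> (e i, 0) \<in> H"
      using d partial_hom_const[OF H, of 0] unfolding e_def by auto
    have e_sum: "(\<Sum>i\<le>n'. e i x * g' x ^ i) = 0" for x
    proof -
      have "(\<Sum>i\<le>n'. e i x * g' x ^ i) = (\<Sum>i\<le>m'. d' i x * g' x ^ i)"
        using le by (intro sum.mono_neutral_cong_right) (auto simp: e_def)
      then show ?thesis using d(3) by simp
    qed
    \<comment> \<open>This is \<open>e 0\<close> times the first relation minus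
      \<open>b' n' * f' ^ n'\<close> times the second, rewritten in powers of \<open>f'\<close>. The
      coefficients of \<open>f' ^ n'\<close> cancel, and the constant one keeps the value 1 because
      \<open>b' n'\<close> has value 0.\<close>
    define c where "c i x = e 0 x * b' i x - b' n' x * e (n' - i) x" for i x
    have c_sum: "(\<Sum>i\<le>k. c i x * f' x ^ i) = 0" for x
    proof -
      have pw: "f' x ^ i = f' x ^ n' * g' x ^ (n' - i)" if "i \<le> n'" for i
      proof -
        have "f' x ^ n' * g' x ^ (n' - i) = f' x ^ i * (f' x * g' x) ^ (n' - i)"
          using that by (simp add: power_mult_distrib mult.assoc[symmetric] power_add[symmetric])
        then show ?thesis using fg by simp
      qed
      have "(\<Sum>i\<le>n'. c i x * f' x ^ i)
          = e 0 x * (\<Sum>i\<le>n'. b' i x * f' x ^ i) - b' n' x * (\<Sum>i\<le>n'. e (n' - i) x * f' x ^ i)"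
        by (simp add: c_def left_diff_distrib sum_subtractf sum_distrib_left mult.assoc)
      also have "(\<Sum>i\<le>n'. e (n' - i) x * f' x ^ i) = (\<Sum>i\<le>n'. f' x ^ n' * (e (n' - i) x * g' x ^ (n' - i)))"
        by (intro sum.cong refl) (simp add: pw[symmetric] mult.left_commute)
      also have "\<dots> = f' x ^ n' * (\<Sum>i\<le>n'. e i x * g' x ^ i)"
        using sum.nat_diff_reindex[of "\<lambda>i. e i x * g' x ^ i" "Suc n'"]
        by (simp only: sum_distrib_left[symmetric] lessThan_Suc_atMost diff_Suc_Suc)
      finally have "(\<Sum>i\<le>n'. c i x * f' x ^ i) = 0" using b(3) e_sum by simp
      moreover have "c n' x = 0" by (simp add: c_def)
      ultimately show ?thesis by (simp add: Suc)
    qed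
    have n0: "(b' n', 0) \<in> H" using b(2) Suc by simp
    have c_mem: "(c i, a * v - 0 * w) \<in> H" if "(e 0, a) \<in> H" "(b' i, v) \<in> H" "(e (n' - i), w) \<in> H" for i a v w
      unfolding c_def by (intro partial_hom_diff[OF H] partial_hom_mult[OF H] that n0)
    have eH: "\<exists>w. (e i, w) \<in> H" for i using e0 e1 by (cases "i = 0") auto
    have c0: "(c 0, 1) \<in> H" and c1: "\<And>i. i > 0 \<Longrightarrow> (c i, 0) \<in> H"
    proof -
      obtain w where "(e (n' - 0), w) \<in> H" using eH by blast
      from c_mem[OF e0 b(1) this] show "(c 0, 1) \<in> H" by simp
      fix i :: nat assume "i > 0"
      obtain w where "(e (n' - i), w) \<in> H" using eH by blast
      from c_mem[OF e0 b(2)[OF \<open>i > 0\<close>] this] show "(c i, 0) \<in> H" by simp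
    qed
    show False
      by (rule less.hyps[of k m' f' g' c d']) (use sz Suc fg c0 c1 c_sum d in auto)
  qed
  show False
  proof (cases "m \<le> n")
    case True
    show ?thesis by (rule step[of m n f g b d]) (use True less.prems in auto)
  next
    case False
    show ?thesis by (rule step[of n m g f d b]) (use False less.prems in \<open>auto simp: mult.commute\<close>)
  qed
qed

text \<open>Otherwise \<open>f\<close> and its inverse would both satisfy relations whose constant
  coefficient has value 1 and whose other coefficients have value 0, which
  \<open>no_two_relations\<close> excludes.\<close>

lemma maximal_hom_valuation:
  assumes max: "maximal_hom H" and f: "\<And>x. f x \<noteq> 0"
  shows "(\<exists>a. (f, a) \<in> H) \<or> (\<exists>a. (\<lambda>x. 1 / f x, a) \<in> H)"
proof (rule ccontr)
  assume contra: "\<not> ?thesis"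
  have H: "partial_hom H" using max unfolding maximal_hom_def by blast
  obtain n b where b: "(b 0, 1) \<in> H" "\<And>i. i > 0 \<Longrightarrow> (b i, 0) \<in> H"
    "\<And>x. (\<Sum>i\<le>n. b i x * f x ^ i) = 0"
    by (rule no_value_relation[OF max, of f]) (use contra in auto)
  obtain m d where d: "(d 0, 1) \<in> H" "\<And>i. i > 0 \<Longrightarrow> (d i, 0) \<in> H"
    "\<And>x. (\<Sum>i\<le>m. d i x * (1 / f x) ^ i) = 0"
    by (rule no_value_relation[OF max, of "\<lambda>x. 1 / f x"]) (use contra in auto)
  show False by (rule no_two_relations[OF H _ b d]) (use f in auto)
qed

text \<open>The values of indicators act like an ultrafilter on the points. As an indicator may
  vanish, the valuation property is applied to \<open>1 + e\<close>; idempotence then leaves only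
  the values 0 and 1.\<close>

lemma maximal_hom_indicator:
  assumes max: "maximal_hom H"
  shows "(\<lambda>x. if P x then 1 else 0, 1) \<in> H \<or> (\<lambda>x. if P x then 1 else 0, 0) \<in> H"
proof -
  have H: "partial_hom H" using max unfolding maximal_hom_def by blast
  define e :: "'a \<Rightarrow> complex" where "e x = (if P x then 1 else 0)" for x
  have "(\<exists>a. (\<lambda>x. 1 + e x, a) \<in> H) \<or> (\<exists>a. (\<lambda>x. 1 / (1 + e x), a) \<in> H)"
    by (rule maximal_hom_valuation[OF max]) (simp add: e_def)
  then have "\<exists>a. (e, a) \<in> H"
  proof (elim disjE exE)
    fix a assume "(\<lambda>x. 1 + e x, a) \<in> H"
    from partial_hom_diff[OF H this partial_hom_const[OF H, of 1]] show ?thesis by auto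
  next
    fix a assume "(\<lambda>x. 1 / (1 + e x), a) \<in> H"
    from partial_hom_mult[OF H partial_hom_const[OF H, of 2]
        partial_hom_diff[OF H partial_hom_const[OF H, of 1] this]]
    have "(\<lambda>x. 2 * (1 - 1 / (1 + e x)), 2 * (1 - a)) \<in> H" .
    \<comment> \<open>The identity holds at the two values 0 and 1 of \<open>e\<close>.\<close>
    moreover have "(\<lambda>x. 2 * (1 - 1 / (1 + e x))) = e" by (auto simp: e_def)
    ultimately show ?thesis by auto
  qed
  then obtain a where a: "(e, a) \<in> H" ..
  have "(\<lambda>x. e x * e x) = e" by (auto simp: e_def)
  then have "(e, a * a) \<in> H" using partial_hom_mult[OF H a a] by simp
  then have "a * a = a" using partial_hom_unique[OF H _ a] by blast
  then have "a = 1 \<or> a = 0" by auto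
  moreover have "e = (\<lambda>x. if P x then 1 else 0)" by (simp add: e_def fun_eq_iff)
  ultimately show ?thesis using a by metis
qed

lemma finite_total_preorder_max:
  assumes "finite I" "I \<noteq> {}"
    and "\<And>i j. i \<in> I \<Longrightarrow> j \<in> I \<Longrightarrow> le i j \<or> le j i"
    and "\<And>i j k. i \<in> I \<Longrightarrow> j \<in> I \<Longrightarrow> k \<in> I \<Longrightarrow> le i j \<Longrightarrow> le j k \<Longrightarrow> le i k"
  shows "\<exists>j\<in>I. \<forall>i\<in>I. le i j"
  using assms
proof (induction I rule: finite_ne_induct)
  case (singleton i)
  then show ?case by blast
next
  case (insert i I)
  have "\<exists>j\<in>I. \<forall>i\<in>I. le i j"
    by (rule insert.IH) (use insert.prems in blast)+
  then obtain j where j: "j \<in> I" "\<forall>i\<in>I. le i j" by blast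
  show ?case
  proof (cases "le i j")
    case False
    then have "le j i" using insert.prems(1)[of i j] j(1) by blast
    then have "\<forall>k\<in>I. le k i" using insert.prems(2)[of _ j i] j by blast
    moreover have "le i i" using insert.prems(1)[of i i] by blast
    ultimately show ?thesis by blast
  qed (use j in blast)
qed

text \<open>Projective points have limits: after dividing by a dominating coordinate, every coordinate
  lies in the domain of the homomorphism.\<close>

lemma maximal_hom_projective_limit:
  fixes c :: "'i \<Rightarrow> 'x \<Rightarrow> complex"
  assumes max: "maximal_hom H" and fin: "finite I"
    and nz: "\<And>x. \<exists>i\<in>I. c i x \<noteq> 0"
  obtains l z where "\<And>i. i \<in> I \<Longrightarrow> (\<lambda>x. l x * c i x, z i) \<in> H" "\<exists>i\<in>I. z i \<noteq> 0"
proof -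
  have H: "partial_hom H" using max unfolding maximal_hom_def by blast
  define ind :: "('x \<Rightarrow> bool) \<Rightarrow> 'x \<Rightarrow> complex" where "ind P = (\<lambda>x. if P x then 1 else 0)" for P
  have ind01: "(ind P, 1) \<in> H \<or> (ind P, 0) \<in> H" for P
    using maximal_hom_indicator[OF max] unfolding ind_def .
  have ind_not: "(ind (\<lambda>x. \<not> P x), 1) \<in> H" if "(ind P, 0) \<in> H" for P
  proof -
    have "(\<lambda>x. 1 - ind P x) = ind (\<lambda>x. \<not> P x)" by (auto simp: ind_def)
    then show ?thesis using partial_hom_diff[OF H partial_hom_const[OF H, of 1] that] by simp
  qed
  have ind_conj: "(ind (\<lambda>x. \<forall>i\<in>J. P i x), 1) \<in> H"
    if "finite J" "\<And>i. i \<in> J \<Longrightarrow> (ind (P i), 1) \<in> H" for J :: "'i set" and P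
    using that
  proof (induction J rule: finite_induct)
    case empty
    then show ?case using partial_hom_const[OF H, of 1] by (simp add: ind_def)
  next
    case (insert i J)
    have "(\<lambda>x. ind (P i) x * ind (\<lambda>x. \<forall>i\<in>J. P i x) x) = ind (\<lambda>x. \<forall>i\<in>insert i J. P i x)"
      by (auto simp: ind_def)
    then show ?case
      using partial_hom_mult[OF H insert.prems[of i] insert.IH] insert.prems by simp
  qed
  \<comment> \<open>\<open>I1\<close> collects the coordinates that are nonzero almost everywhere,
    in the sense that the indicator has value 1. On \<open>N\<close> exactly these are nonzero, and
    \<open>N\<close> itself is large in this sense.\<close>
  define I1 where "I1 = {i\<in>I. (ind (\<lambda>x. c i x \<noteq> 0), 1) \<in> H}"
  define N where "N x \<longleftrightarrow> (\<forall>i\<in>I. c i x \<noteq> 0 \<longleftrightarrow> i \<in> I1)" for x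
  have N: "(ind N, 1) \<in> H"
    unfolding N_def[abs_def]
  proof (rule ind_conj[OF fin])
    fix i assume "i \<in> I"
    show "(ind (\<lambda>x. (c i x \<noteq> 0) = (i \<in> I1)), 1) \<in> H"
    proof (cases "i \<in> I1")
      case False
      then have "(ind (\<lambda>x. c i x \<noteq> 0), 0) \<in> H" using ind01 \<open>i \<in> I\<close> unfolding I1_def by blast
      from ind_not[OF this] show ?thesis using False by simp
    qed (simp add: I1_def)
  qed
  have "I1 \<noteq> {}"
  proof
    assume "I1 = {}"
    then have "ind N = (\<lambda>_. 0)" using nz unfolding N_def ind_def by auto
    then show False using N partial_hom_zero[OF H] by fastforce
  qed
  \<comment> \<open>Zeros are replaced by 1 so that all quotients are nowhere vanishing; on
    \<open>N\<close> this changes no coordinate of \<open>I1\<close>.\<close>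
  define c' where "c' i x = (if c i x = 0 then 1 else c i x)" for i x
  have c'_nz: "c' i x \<noteq> 0" for i x by (simp add: c'_def)
  define le where "le i j \<longleftrightarrow> (\<exists>a. (\<lambda>x. c' i x / c' j x, a) \<in> H)" for i j
  have total: "le i j \<or> le j i" for i j
    using maximal_hom_valuation[OF max, of "\<lambda>x. c' i x / c' j x"] c'_nz by (auto simp: le_def)
  have trans: "le i k" if "le i j" "le j k" for i j k
  proof -
    obtain a b where ab: "(\<lambda>x. c' i x / c' j x, a) \<in> H" "(\<lambda>x. c' j x / c' k x, b) \<in> H"
      using \<open>le i j\<close> \<open>le j k\<close> unfolding le_def by blast
    have "(\<lambda>x. c' i x / c' j x * (c' j x / c' k x)) = (\<lambda>x. c' i x / c' k x)"
      using c'_nz by auto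
    then show ?thesis using partial_hom_mult[OF H ab] unfolding le_def by auto
  qed
  have "\<exists>j\<in>I1. \<forall>i\<in>I1. le i j"
    by (rule finite_total_preorder_max[OF _ \<open>I1 \<noteq> {}\<close> total trans])
       (simp add: I1_def fin)
  then obtain j where j: "j \<in> I1" "\<And>i. i \<in> I1 \<Longrightarrow> le i j" by blast
  \<comment> \<open>The factor \<open>ind N\<close> removes the points where the replacement matters
    and turns the dominating coordinate into \<open>ind N\<close>, whose value is 1.\<close>
  define l where "l x = ind N x / c' j x" for x
  have ex: "\<exists>a. (\<lambda>x. l x * c i x, a) \<in> H" if "i \<in> I" for i
  proof (cases "i \<in> I1")
    case True
    then obtain a where a: "(\<lambda>x. c' i x / c' j x, a) \<in> H" using j(2) unfolding le_def by blast
    have "(\<lambda>x. ind N x * (c' i x / c' j x)) = (\<lambda>x. l x * c i x)"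
      using True that by (auto simp: l_def ind_def N_def c'_def)
    then show ?thesis using partial_hom_mult[OF H N a] by auto
  next
    case False
    then have "l x * c i x = 0" for x
      using that by (cases "N x") (auto simp: l_def ind_def N_def)
    then have "(\<lambda>x. l x * c i x) = (\<lambda>_. 0)" by blast
    then show ?thesis using partial_hom_const[OF H] by metis
  qed
  define z where "z i = (SOME a. (\<lambda>x. l x * c i x, a) \<in> H)" for i
  have z: "(\<lambda>x. l x * c i x, z i) \<in> H" if "i \<in> I" for i
    unfolding z_def using someI_ex[OF ex[OF that]] .
  have jI: "j \<in> I" using j(1) unfolding I1_def by blast
  have "l x * c j x = ind N x" for x
    using j(1) jI by (cases "N x") (auto simp: l_def ind_def N_def c'_def)
  then have "(\<lambda>x. l x * c j x) = ind N" by blast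
  then have "z j = 1" using partial_hom_unique[OF H _ N] z[OF jI] by simp
  then show ?thesis using that z jI by (metis zero_neq_one)
qed


section \<open>Apolar spaces of tensors of rank six\<close>

lemma homogeneous_system:
  fixes a :: "'i \<Rightarrow> 'j \<Rightarrow> complex"
  assumes "finite I" "finite J" "card I < card J"
  shows "\<exists>c. (\<exists>j\<in>J. c j \<noteq> 0) \<and> (\<forall>i\<in>I. (\<Sum>j\<in>J. a i j * c j) = 0)"
  using assms
proof (induction I arbitrary: J a rule: finite_induct)
  case empty
  then show ?case by (intro exI[of _ "\<lambda>_. 1"]) (auto simp: card_gt_0_iff)
next
  case (insert i I)
  show ?case
  proof (cases "\<forall>j\<in>J. a i j = 0")
    case True
    have "card I < card J" using insert.prems insert.hyps by simp
    from insert.IH[OF insert.prems(1) this, of a] True show ?thesis by auto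
  next
    case False
    then obtain k where k: "k \<in> J" "a i k \<noteq> 0" by blast
    define J' where "J' = J - {k}"
    have J': "finite J'" "card I < card J'" "J = insert k J'" "k \<notin> J'"
      using insert.prems insert.hyps k(1) by (auto simp: J'_def)
    obtain c where c: "\<exists>j\<in>J'. c j \<noteq> 0"
      "\<And>i'. i' \<in> I \<Longrightarrow> (\<Sum>j\<in>J'. (a i' j - a i' k * a i j / a i k) * c j) = 0"
      \<comment> \<open>These coefficients remain after equation \<open>i\<close> is solved for the
        unknown \<open>k\<close>.\<close>
      using insert.IH[OF J'(1,2), of "\<lambda>i' j. a i' j - a i' k * a i j / a i k"] by blast
    define d where "d j = (if j = k then - (\<Sum>j\<in>J'. a i j * c j) / a i k else c j)" for j
    have d_sum: "(\<Sum>j\<in>J. a i' j * d j) = a i' k * d k + (\<Sum>j\<in>J'. a i' j * c j)" for i'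
    proof -
      have "(\<Sum>j\<in>J'. a i' j * d j) = (\<Sum>j\<in>J'. a i' j * c j)"
        using J'(4) by (intro sum.cong) (auto simp: d_def)
      then show ?thesis using J' by simp
    qed
    have "(\<Sum>j\<in>J. a i j * d j) = 0"
      unfolding d_sum using k(2) by (simp add: d_def)
    moreover have "(\<Sum>j\<in>J. a i' j * d j) = 0" if "i' \<in> I" for i'
    proof -
      have "(\<Sum>j\<in>J'. (a i' j - a i' k * a i j / a i k) * c j)
          = (\<Sum>j\<in>J'. a i' j * c j) - a i' k / a i k * (\<Sum>j\<in>J'. a i j * c j)"
        by (simp add: left_diff_distrib sum_subtractf sum_distrib_left mult.assoc)
      then show ?thesis using c(2)[OF that] unfolding d_sum by (simp add: d_def)
    qed
    moreover have "\<exists>j\<in>J. d j \<noteq> 0" using c(1) J' unfolding d_def by auto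
    ultimately show ?thesis by blast
  qed
qed

definition lin_indep :: "nat set \<Rightarrow> (nat \<Rightarrow> mi \<Rightarrow> complex) \<Rightarrow> (nat \<Rightarrow> mi \<Rightarrow> complex) \<Rightarrow> bool" where
  "lin_indep L u v \<longleftrightarrow>
     (\<forall>c. (\<forall>a b. (\<Sum>l\<in>L. c l * (u l a * v l b)) = 0) \<longrightarrow> (\<forall>l\<in>L. c l = 0))"

text \<open>A dependency expresses one product through the others, so its term can be absorbed into
  their third factors.\<close>

lemma lin_indep_decomposition:
  fixes s :: tensor
  assumes "finite L" "\<And>a b z. s a b z = (\<Sum>l\<in>L. u l a * v l b * w l z)"
  obtains K w' where "K \<subseteq> L" "lin_indep K u v" "\<And>a b z. s a b z = (\<Sum>l\<in>K. u l a * v l b * w' l z)"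
proof -
  have "\<exists>K w'. K \<subseteq> L \<and> lin_indep K u v \<and> (\<forall>a b z. s a b z = (\<Sum>l\<in>K. u l a * v l b * w' l z))"
    using assms
  proof (induction L arbitrary: w rule: finite_psubset_induct)
    case (psubset L)
    show ?case
    proof (cases "lin_indep L u v")
      case False
      then obtain c k where c: "\<And>a b. (\<Sum>l\<in>L. c l * (u l a * v l b)) = 0" and k: "k \<in> L" "c k \<noteq> 0"
        unfolding lin_indep_def by blast
      have split: "(\<Sum>l\<in>L. f l) = f k + (\<Sum>l\<in>L - {k}. f l)" for f :: "nat \<Rightarrow> complex"
        using psubset.hyps k(1) by (rule sum.remove)
      have "s a b z = (\<Sum>l\<in>L - {k}. u l a * v l b * (w l z - c l / c k * w k z))" for a b z
      proof -
        have "u k a * v k b = - (\<Sum>l\<in>L - {k}. c l * (u l a * v l b)) / c k"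
          using c[of a b] k(2) unfolding split
          by (simp add: field_simps eq_neg_iff_add_eq_0)
        then have "u k a * v k b * w k z = (\<Sum>l\<in>L - {k}. - (c l * (u l a * v l b)) / c k * w k z)"
          by (simp add: sum_distrib_right sum_negf sum_divide_distrib)
        then show ?thesis
          unfolding psubset.prems split
          by (simp add: sum.distrib[symmetric] algebra_simps)
      qed
      moreover have "L - {k} \<subset> L" using k(1) by blast
      ultimately obtain K w' where "K \<subseteq> L - {k}" "lin_indep K u v"
        "\<forall>a b z. s a b z = (\<Sum>l\<in>K. u l a * v l b * w' l z)"
        using psubset.IH[of "L - {k}" "\<lambda>l z. w l z - c l / c k * w k z"] by auto
      then show ?thesis by blast
    qed (use psubset.prems in blast)
  qed
  then show ?thesis using that by blast
qed

text \<open>The sixteen elementary products cannot all lie in a span of fewer than sixteen vectors.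
  One outside the span is appended, since the new member must again be a product.\<close>

lemma lin_indep_extend:
  assumes fin: "finite L" and card: "card L < 16" and indep: "lin_indep L u v"
  obtains n u' v' where "n \<notin> L" "lin_indep (insert n L) u' v'"
    "\<And>l. l \<in> L \<Longrightarrow> u' l = u l \<and> v' l = v l"
proof -
  define E :: "mi \<times> mi \<Rightarrow> mi \<Rightarrow> mi \<Rightarrow> complex" where
    "E p a b = (if a = fst p then 1 else 0) * (if b = snd p then 1 else 0)" for p a b
  have "\<exists>p. \<nexists>k. \<forall>a b. E p a b = (\<Sum>l\<in>L. k l * (u l a * v l b))"
  proof (rule ccontr)
    assume "\<not> ?thesis"
    then have "\<forall>p. \<exists>k. \<forall>a b. E p a b = (\<Sum>l\<in>L. k l * (u l a * v l b))" by blast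
    then obtain k where k: "\<And>p a b. E p a b = (\<Sum>l\<in>L. k p l * (u l a * v l b))" by metis
    have "card L < card (UNIV :: (mi \<times> mi) set)" using card by simp
    then obtain c where c: "\<exists>p. c p \<noteq> 0" "\<And>l. l \<in> L \<Longrightarrow> (\<Sum>p\<in>UNIV. k p l * c p) = 0"
      using homogeneous_system[OF fin finite_class.finite_UNIV, of "\<lambda>l p. k p l"] by blast
    have "c (a, b) = 0" for a b
    proof -
      have "c (a, b) = (\<Sum>p\<in>UNIV. c p * E p a b)"
      proof -
        have "c p * E p a b = (if p = (a, b) then c p else 0)" for p by (auto simp: E_def prod_eq_iff)
        then show ?thesis by simp
      qed
      also have "\<dots> = (\<Sum>p\<in>UNIV. \<Sum>l\<in>L. k p l * c p * (u l a * v l b))"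
        by (simp add: k sum_distrib_left mult_ac)
      also have "\<dots> = (\<Sum>l\<in>L. (\<Sum>p\<in>UNIV. k p l * c p) * (u l a * v l b))"
        by (subst sum.swap) (simp add: sum_distrib_right)
      finally show ?thesis using c(2) by simp
    qed
    then show False using c(1) by auto
  qed
  then obtain p where p: "\<nexists>k. \<forall>a b. E p a b = (\<Sum>l\<in>L. k l * (u l a * v l b))" ..
  obtain n where n: "n \<notin> L" using fin ex_new_if_finite infinite_UNIV_nat by blast
  define u' where "u' = u(n := \<lambda>a. if a = fst p then 1 else 0)"
  define v' where "v' = v(n := \<lambda>b. if b = snd p then 1 else 0)"
  have "lin_indep (insert n L) u' v'"
    unfolding lin_indep_def
  proof (intro allI impI)
    fix c assume "\<forall>a b. (\<Sum>l\<in>insert n L. c l * (u' l a * v' l b)) = 0"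
    moreover have "(\<Sum>l\<in>insert n L. c l * (u' l a * v' l b)) = c n * E p a b + (\<Sum>l\<in>L. c l * (u l a * v l b))"
      for a b
    proof -
      have "(\<Sum>l\<in>L. c l * (u' l a * v' l b)) = (\<Sum>l\<in>L. c l * (u l a * v l b))"
        using n by (intro sum.cong) (auto simp: u'_def v'_def)
      then show ?thesis using n fin by (simp add: u'_def v'_def E_def)
    qed
    ultimately have eq: "c n * E p a b + (\<Sum>l\<in>L. c l * (u l a * v l b)) = 0" for a b by metis
    have "c n = 0"
    proof (rule ccontr)
      assume "c n \<noteq> 0"
      then have "E p a b = (\<Sum>l\<in>L. - c l / c n * (u l a * v l b))" for a b
        using eq[of a b]
        by (simp add: sum_negf sum_divide_distrib[symmetric] field_simps eq_neg_iff_add_eq_0)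
      then have "\<exists>k. \<forall>a b. E p a b = (\<Sum>l\<in>L. k l * (u l a * v l b))"
        by (intro exI[of _ "\<lambda>l. - c l / c n"]) blast
      then show False using p by contradiction
    qed
    moreover from this have "\<forall>l\<in>L. c l = 0" using indep eq unfolding lin_indep_def by auto
    ultimately show "\<forall>l\<in>insert n L. c l = 0" by blast
  qed
  moreover have "u' l = u l \<and> v' l = v l" if "l \<in> L" for l
    using that n by (auto simp: u'_def v'_def)
  ultimately show ?thesis using that n by blast
qed

text \<open>Padding terms get third factor zero, which leaves the tensor unchanged. Exactly six
  products are wanted because ampleness bounds dimensions from below.\<close>

lemma rank_le_6_lin_indep:
  assumes "rank_le s 6"
  obtains L u v w where "finite L" "card L = 6" "lin_indep L u v"
    "\<And>a b z. s a b z = (\<Sum>l\<in>L. u l a * v l b * w l z)"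
proof -
  have pad: "\<exists>L u v w. finite L \<and> card L = 6 \<and> lin_indep L u v \<and>
      (\<forall>a b z. s a b z = (\<Sum>l\<in>L. u l a * v l b * w l z))"
    if "finite L" "card L \<le> 6" "lin_indep L u v"
      "\<And>a b z. s a b z = (\<Sum>l\<in>L. u l a * v l b * w l z)" for L u v w
    using that
  proof (induction "6 - card L" arbitrary: L u v w)
    case 0
    then have "card L = 6" by simp
    then show ?case using 0 by blast
  next
    case (Suc m)
    obtain n u' v' where n: "n \<notin> L" "lin_indep (insert n L) u' v'"
      "\<And>l. l \<in> L \<Longrightarrow> u' l = u l \<and> v' l = v l"
      using lin_indep_extend[of L u v] Suc.prems by auto
    define w' where "w' = w(n := \<lambda>_. 0)"
    show ?case
    proof (rule Suc.hyps(1)[of "insert n L" u' v' w'])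
      show "m = 6 - card (insert n L)" "card (insert n L) \<le> 6"
        using Suc.hyps(2) Suc.prems(1) n(1) by auto
      fix a b z
      have "(\<Sum>l\<in>L. u' l a * v' l b * w' l z) = (\<Sum>l\<in>L. u l a * v l b * w l z)"
        using n by (intro sum.cong) (auto simp: w'_def)
      then show "s a b z = (\<Sum>l\<in>insert n L. u' l a * v' l b * w' l z)"
        using Suc.prems(1,4) n(1) by (simp add: w'_def)
    qed (use Suc.prems n in auto)
  qed
  obtain u v w :: "nat \<Rightarrow> mi \<Rightarrow> complex" where "s = (\<lambda>x y z. \<Sum>l<6. u l x * v l y * w l z)"
    using assms unfolding rank_le_def by blast
  then have s: "s a b z = (\<Sum>l<6. u l a * v l b * w l z)" for a b z by simp
  obtain K w' where K: "K \<subseteq> {..<6}" "lin_indep K u v"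
      "\<And>a b z. s a b z = (\<Sum>l\<in>K. u l a * v l b * w' l z)"
    by (rule lin_indep_decomposition[of "{..<6}" s u v w]) (use s in blast)+
  have "finite K" "card K \<le> 6"
    using finite_subset[OF K(1)] card_mono[OF finite_lessThan K(1)] by auto
  from pad[OF this K(2,3)] show ?thesis using that by (elim exE conjE) blast
qed

section \<open>Ampleness and apolarity\<close>

definition sym_left :: "mi \<times> mi \<times> mi \<Rightarrow> mi \<times> mi \<times> mi" where
  "sym_left = (\<lambda>(p, a, b). (a, p, b))"

definition sym_right :: "mi \<times> mi \<times> mi \<Rightarrow> mi \<times> mi \<times> mi" where
  "sym_right = (\<lambda>(p, a, b). (b, a, p))"

text \<open>For \<open>\<pi> = sym_left\<close> this says that \<open>A \<otimes> F \<inter> S\<^sup>2A \<otimes> B\<close> has dimension at least six, for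
  \<open>\<pi> = sym_right\<close> that \<open>F \<otimes> B \<inter> A \<otimes> S\<^sup>2B\<close> does (with the new factor listed first). Prescribing zeros
  at five coordinates is the form of the condition that passes to limits of projective points.\<close>

definition ample :: "(mi \<Rightarrow> mi \<Rightarrow> complex) set \<Rightarrow> (mi \<times> mi \<times> mi \<Rightarrow> mi \<times> mi \<times> mi) \<Rightarrow> bool" where
  "ample F \<pi> \<longleftrightarrow> (\<forall>R. card R \<le> 5 \<longrightarrow>
     (\<exists>g. (\<exists>x. g x \<noteq> 0) \<and> (\<forall>x\<in>R. g x = 0) \<and> (\<forall>x. g (\<pi> x) = g x) \<and>
          (\<forall>p. (\<lambda>a b. g (p, a, b)) \<in> F)))"

text \<open>The second clause expresses \<open>dim F \<le> 6\<close>: three members of \<open>F\<close> and the four slices of \<open>s\<close> are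
  always dependent.\<close>

definition apolar :: "tensor \<Rightarrow> (mi \<Rightarrow> mi \<Rightarrow> complex) set \<Rightarrow> bool" where
  "apolar s F \<longleftrightarrow>
     (\<forall>z. (\<lambda>a b. s a b z) \<in> F) \<and>
     (\<forall>f :: 3 \<Rightarrow> mi \<Rightarrow> mi \<Rightarrow> complex. (\<forall>k. f k \<in> F) \<longrightarrow>
        (\<exists>c :: 3 + mi \<Rightarrow> complex. (\<exists>i. c i \<noteq> 0) \<and>
          (\<forall>a b. (\<Sum>k\<in>UNIV. c (Inl k) * f k a b) + (\<Sum>z\<in>UNIV. c (Inr z) * s a b z) = 0))) \<and>
     ample F sym_left \<and> ample F sym_right"

text \<open>For \<open>q = u\<close> or \<open>q = v\<close> the six tensors built from
  \<open>q l\<close>, \<open>u l\<close>, \<open>v l\<close> are invariant under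
  \<open>\<pi>\<close>. Five linear conditions on six coefficients have a nonzero solution, and
  independence of the products keeps the combination nonzero.\<close>

lemma ample_span:
  assumes fin: "finite L" and card: "card L = 6" and indep: "lin_indep L u v"
    and F: "\<And>c. (\<lambda>a b. \<Sum>l\<in>L. c l * (u l a * v l b)) \<in> F"
    and q: "\<And>l. l \<in> L \<Longrightarrow> \<exists>p. q l p \<noteq> 0"
    and sym: "\<And>l p a b. (case \<pi> (p, a, b) of (p', a', b') \<Rightarrow> q l p' * u l a' * v l b') = q l p * u l a * v l b"
  shows "ample F \<pi>"
  unfolding ample_def
proof (intro allI impI)
  fix R :: "(mi \<times> mi \<times> mi) set" assume R: "card R \<le> 5"
  define e where "e x l = (case x of (p, a, b) \<Rightarrow> q l p * u l a * v l b)" for x l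
  obtain c where c: "\<exists>l\<in>L. c l \<noteq> 0" "\<And>x. x \<in> R \<Longrightarrow> (\<Sum>l\<in>L. e x l * c l) = 0"
    using homogeneous_system[of R L e] fin card R by auto
  define g where "g x = (\<Sum>l\<in>L. e x l * c l)" for x
  obtain l p where l: "l \<in> L" "c l \<noteq> 0" "q l p \<noteq> 0" using c(1) q by blast
  have g_eq: "(\<lambda>a b. g (p, a, b)) = (\<lambda>a b. \<Sum>l\<in>L. (q l p * c l) * (u l a * v l b))" for p
    by (simp add: g_def e_def mult_ac)
  have "\<exists>a b. g (p, a, b) \<noteq> 0"
  proof (rule ccontr)
    assume "\<not> ?thesis"
    then have "(\<Sum>l\<in>L. (q l p * c l) * (u l a * v l b)) = 0" for a b
      using g_eq[of p] by (metis (no_types, lifting))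
    then have "q l p * c l = 0" using indep l(1) unfolding lin_indep_def by meson
    then show False using l by simp
  qed
  moreover have "g (\<pi> x) = g x" for x
    unfolding g_def e_def using sym by (cases x) simp
  ultimately show "\<exists>g. (\<exists>x. g x \<noteq> 0) \<and> (\<forall>x\<in>R. g x = 0) \<and> (\<forall>x. g (\<pi> x) = g x) \<and>
          (\<forall>p. (\<lambda>a b. g (p, a, b)) \<in> F)"
    using c(2) F g_eq unfolding g_def[symmetric] by (intro exI[of _ g]) (auto simp del: split_paired_All split_paired_Ex)
qed

lemma rank_le_6_apolar:
  assumes "rank_le s 6"
  obtains F where "apolar s F" "\<And>c f. f \<in> F \<Longrightarrow> (\<lambda>a b. c * f a b) \<in> F"
proof -
  obtain L u v w where fin: "finite L" and card: "card L = 6" and indep: "lin_indep L u v"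
    and s: "\<And>a b z. s a b z = (\<Sum>l\<in>L. u l a * v l b * w l z)"
    by (rule rank_le_6_lin_indep[OF assms]) blast
  define F where "F = range (\<lambda>c a b. \<Sum>l\<in>L. c l * (u l a * v l b))"
  have F: "(\<lambda>a b. \<Sum>l\<in>L. c l * (u l a * v l b)) \<in> F" for c unfolding F_def by blast
  have nz: "\<exists>a. u l a \<noteq> 0" "\<exists>b. v l b \<noteq> 0" if "l \<in> L" for l
  proof -
    have "\<exists>a b. u l a * v l b \<noteq> 0"
    proof (rule ccontr)
      assume "\<not> ?thesis"
      then have "u l a * v l b = 0" for a b by blast
      then have "(\<Sum>l'\<in>L. (if l' = l then 1 else 0) * (u l' a * v l' b)) = 0" for a b
        by (intro sum.neutral ballI) simp
      from indep[unfolded lin_indep_def, rule_format, OF this \<open>l \<in> L\<close>] show False by simp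
    qed
    then obtain a b where "u l a * v l b \<noteq> 0" by blast
    then have "u l a \<noteq> 0" "v l b \<noteq> 0" by simp_all
    then show "\<exists>a. u l a \<noteq> 0" "\<exists>b. v l b \<noteq> 0" by blast+
  qed
  have "apolar s F"
    unfolding apolar_def
  proof (intro conjI allI impI)
    show "(\<lambda>a b. s a b z) \<in> F" for z
      using F[of "\<lambda>l. w l z"] by (simp add: s mult_ac)
    show "ample F sym_left"
      by (rule ample_span[OF fin card indep F nz(1)]) (auto simp: sym_left_def)
    show "ample F sym_right"
      by (rule ample_span[OF fin card indep F nz(2)]) (auto simp: sym_right_def)
  next
    fix f :: "3 \<Rightarrow> mi \<Rightarrow> mi \<Rightarrow> complex" assume "\<forall>k. f k \<in> F"
    then have "\<forall>k. \<exists>d. f k = (\<lambda>a b. \<Sum>l\<in>L. d l * (u l a * v l b))" unfolding F_def by blast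
    from choice[OF this] obtain d where d: "\<And>k. f k = (\<lambda>a b. \<Sum>l\<in>L. d k l * (u l a * v l b))" by blast
    \<comment> \<open>Three members of \<open>F\<close> and four slices are seven vectors in the
      span of six.\<close>
    have "card L < card (UNIV :: (3 + mi) set)" by (simp add: card)
    then obtain c :: "3 + mi \<Rightarrow> complex" where c: "\<exists>i. c i \<noteq> 0"
      "\<And>l. l \<in> L \<Longrightarrow> (\<Sum>i\<in>UNIV. (case i of Inl k \<Rightarrow> d k l | Inr z \<Rightarrow> w l z) * c i) = 0"
      using homogeneous_system[OF fin finite_class.finite_UNIV, of "\<lambda>l i. case i of Inl k \<Rightarrow> d k l | Inr z \<Rightarrow> w l z"]
      by blast
    have "(\<Sum>k\<in>UNIV. c (Inl k) * f k a b) + (\<Sum>z\<in>UNIV. c (Inr z) * s a b z) = 0" for a b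
    proof -
      have "(\<Sum>k\<in>UNIV. c (Inl k) * f k a b) = (\<Sum>l\<in>L. (\<Sum>k\<in>UNIV. d k l * c (Inl k)) * (u l a * v l b))"
        unfolding d sum_distrib_left sum_distrib_right by (subst sum.swap) (simp add: mult_ac)
      moreover have "(\<Sum>z\<in>UNIV. c (Inr z) * s a b z) = (\<Sum>l\<in>L. (\<Sum>z\<in>UNIV. w l z * c (Inr z)) * (u l a * v l b))"
        unfolding s sum_distrib_left sum_distrib_right by (subst sum.swap) (simp add: mult_ac)
      moreover have "(\<Sum>k\<in>UNIV. d k l * c (Inl k)) + (\<Sum>z\<in>UNIV. w l z * c (Inr z)) = 0" if "l \<in> L" for l
        using c(2)[OF that] by (simp add: UNIV_Plus_UNIV[symmetric] sum.Plus del: UNIV_Plus_UNIV)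
      ultimately show ?thesis
        by (simp add: sum.distrib[symmetric] distrib_right[symmetric])
    qed
    then show "\<exists>c :: 3 + mi \<Rightarrow> complex. (\<exists>i. c i \<noteq> 0) \<and>
        (\<forall>a b. (\<Sum>k\<in>UNIV. c (Inl k) * f k a b) + (\<Sum>z\<in>UNIV. c (Inr z) * s a b z) = 0)"
      using c(1) by blast
  qed
  moreover have "(\<lambda>a b. c * f a b) \<in> F" if "f \<in> F" for c f
  proof -
    obtain d where "f = (\<lambda>a b. \<Sum>l\<in>L. d l * (u l a * v l b))" using \<open>f \<in> F\<close> unfolding F_def by blast
    then show ?thesis using F[of "\<lambda>l. c * d l"] by (simp add: sum_distrib_left mult_ac)
  qed
  ultimately show ?thesis using that by blast
qed

text \<open>The limit space consists of the values of sections of the \<open>F x\<close> with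
  coordinates in the domain of \<open>H\<close>. Ampleness and the dimension bound supply nonzero
  witnesses, rescaled pointwise to a nonzero limit; closure under scaling keeps rescaled members in
  \<open>F x\<close>.\<close>

lemma limit_apolar:
  fixes s :: "'x \<Rightarrow> tensor" and t :: tensor
  assumes max: "maximal_hom H"
    and s: "\<And>a b z. (\<lambda>x. s x a b z, t a b z) \<in> H"
    and apolar: "\<And>x. apolar (s x) (F x)"
    and scale: "\<And>x c f. f \<in> F x \<Longrightarrow> (\<lambda>a b. c * f a b) \<in> F x"
  shows "apolar t {f. \<exists>\<phi>. (\<forall>x. \<phi> x \<in> F x) \<and> (\<forall>a b. (\<lambda>x. \<phi> x a b, f a b) \<in> H)}"
proof -
  have H: "partial_hom H" using max unfolding maximal_hom_def by blast
  define G where "G = {f. \<exists>\<phi>. (\<forall>x. \<phi> x \<in> F x) \<and> (\<forall>a b. (\<lambda>x. \<phi> x a b, f a b) \<in> H)}"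
  have GI: "f \<in> G" if "\<And>x. \<phi> x \<in> F x" "\<And>a b. (\<lambda>x. \<phi> x a b, f a b) \<in> H" for f \<phi>
    using that unfolding G_def by blast
  have ample: "ample G \<pi>" if \<pi>: "\<And>x. ample (F x) \<pi>" for \<pi>
    unfolding ample_def
  proof (intro allI impI)
    fix R :: "(mi \<times> mi \<times> mi) set" assume "card R \<le> 5"
    then have "\<forall>x. \<exists>g. (\<exists>y. g y \<noteq> 0) \<and> (\<forall>y\<in>R. g y = 0) \<and> (\<forall>y. g (\<pi> y) = g y) \<and>
          (\<forall>p. (\<lambda>a b. g (p, a, b)) \<in> F x)"
      using \<pi> unfolding ample_def by blast
    from choice[OF this] obtain g where
      "\<forall>x. (\<exists>y. g x y \<noteq> 0) \<and> (\<forall>y\<in>R. g x y = 0) \<and> (\<forall>y. g x (\<pi> y) = g x y) \<and>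
          (\<forall>p. (\<lambda>a b. g x (p, a, b)) \<in> F x)" ..
    then have g: "\<And>x. \<exists>y\<in>UNIV. g x y \<noteq> 0" "\<And>x y. y \<in> R \<Longrightarrow> g x y = 0"
      "\<And>x y. g x (\<pi> y) = g x y" "\<And>x p. (\<lambda>a b. g x (p, a, b)) \<in> F x" by (simp_all del: split_paired_All split_paired_Ex)
    obtain l z where lz: "\<And>y. (\<lambda>x. l x * g x y, z y) \<in> H" "\<exists>y. z y \<noteq> 0"
      by (rule maximal_hom_projective_limit[OF max finite_class.finite_UNIV, of "\<lambda>y x. g x y"])
         (use g(1) in blast)+
    have "z y = 0" if "y \<in> R" for y
      using lz(1)[of y] g(2)[OF that] partial_hom_zero[OF H] by auto
    moreover have "z (\<pi> y) = z y" for y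
      using lz(1)[of "\<pi> y"] lz(1)[of y] g(3) partial_hom_unique[OF H] by auto
    moreover have "(\<lambda>a b. z (p, a, b)) \<in> G" for p
      by (rule GI[of "\<lambda>x a b. l x * g x (p, a, b)"]) (use scale[OF g(4)] lz(1) in auto)
    ultimately show "\<exists>g. (\<exists>x. g x \<noteq> 0) \<and> (\<forall>x\<in>R. g x = 0) \<and> (\<forall>x. g (\<pi> x) = g x) \<and>
          (\<forall>p. (\<lambda>a b. g (p, a, b)) \<in> G)"
      using lz(2) by blast
  qed
  have "apolar t G"
    unfolding apolar_def
  proof (intro conjI allI impI)
    show "(\<lambda>a b. t a b z) \<in> G" for z
    proof (rule GI)
      show "(\<lambda>a b. s x a b z) \<in> F x" for x using apolar[of x] unfolding apolar_def by blast
    qed (rule s)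
    show "ample G sym_left" by (rule ample) (use apolar in \<open>simp add: apolar_def\<close>)
    show "ample G sym_right" by (rule ample) (use apolar in \<open>simp add: apolar_def\<close>)
  next
    fix f :: "3 \<Rightarrow> mi \<Rightarrow> mi \<Rightarrow> complex" assume "\<forall>k. f k \<in> G"
    then have "\<forall>k. \<exists>\<phi>. (\<forall>x. \<phi> x \<in> F x) \<and> (\<forall>a b. (\<lambda>x. \<phi> x a b, f k a b) \<in> H)"
      unfolding G_def by blast
    from choice[OF this] obtain \<phi> where \<phi>: "\<And>k x. \<phi> k x \<in> F x"
      "\<And>k a b. (\<lambda>x. \<phi> k x a b, f k a b) \<in> H" by blast
    have "\<forall>x. \<exists>c :: 3 + mi \<Rightarrow> complex. (\<exists>i. c i \<noteq> 0) \<and>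
        (\<forall>a b. (\<Sum>k\<in>UNIV. c (Inl k) * \<phi> k x a b) + (\<Sum>z\<in>UNIV. c (Inr z) * s x a b z) = 0)"
    proof
      fix x
      show "\<exists>c :: 3 + mi \<Rightarrow> complex. (\<exists>i. c i \<noteq> 0) \<and>
        (\<forall>a b. (\<Sum>k\<in>UNIV. c (Inl k) * \<phi> k x a b) + (\<Sum>z\<in>UNIV. c (Inr z) * s x a b z) = 0)"
        using apolar[of x] \<phi>(1)[of _ x] unfolding apolar_def by (elim conjE allE[of _ "\<lambda>k. \<phi> k x"]) blast
    qed
    from choice[OF this] obtain c :: "'x \<Rightarrow> 3 + mi \<Rightarrow> complex" where c: "\<And>x. \<exists>i. c x i \<noteq> 0"
      "\<And>x a b. (\<Sum>k\<in>UNIV. c x (Inl k) * \<phi> k x a b) + (\<Sum>z\<in>UNIV. c x (Inr z) * s x a b z) = 0"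
      by blast
    obtain l z where lz: "\<And>i. (\<lambda>x. l x * c x i, z i) \<in> H" "\<exists>i. z i \<noteq> 0"
      by (rule maximal_hom_projective_limit[OF max finite_class.finite_UNIV, of "\<lambda>i x. c x i"])
         (use c(1) in blast)+
    have "(\<Sum>k\<in>UNIV. z (Inl k) * f k a b) + (\<Sum>y\<in>UNIV. z (Inr y) * t a b y) = 0" for a b
    proof -
      have "(\<lambda>x. (\<Sum>k\<in>UNIV. l x * c x (Inl k) * \<phi> k x a b) + (\<Sum>y\<in>UNIV. l x * c x (Inr y) * s x a b y),
          (\<Sum>k\<in>UNIV. z (Inl k) * f k a b) + (\<Sum>y\<in>UNIV. z (Inr y) * t a b y)) \<in> H"
        by (intro partial_hom_add[OF H] partial_hom_sum[OF H] partial_hom_mult[OF H] lz(1) \<phi>(2) s)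
      moreover have "(\<Sum>k\<in>UNIV. l x * c x (Inl k) * \<phi> k x a b) + (\<Sum>y\<in>UNIV. l x * c x (Inr y) * s x a b y)
          = l x * ((\<Sum>k\<in>UNIV. c x (Inl k) * \<phi> k x a b) + (\<Sum>z\<in>UNIV. c x (Inr z) * s x a b z))" for x
        by (simp add: distrib_left sum_distrib_left mult.assoc)
      ultimately show ?thesis using c(2) partial_hom_zero[OF H] by simp
    qed
    then show "\<exists>c :: 3 + mi \<Rightarrow> complex. (\<exists>i. c i \<noteq> 0) \<and>
        (\<forall>a b. (\<Sum>k\<in>UNIV. c (Inl k) * f k a b) + (\<Sum>z\<in>UNIV. c (Inr z) * t a b z) = 0)"
      using lz(2) by blast
  qed
  then show ?thesis unfolding G_def .
qed

section \<open>Limits in the Zariski closure\<close>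

lemma poly_fun_monomial:
  "poly_fun (\<lambda>t. c * (\<Prod>k\<in>UNIV. (case k of (x,y,z) \<Rightarrow> t x y z) ^ e k))"
  unfolding poly_fun_def by (rule exI[of _ "{e}"], rule exI[of _ "\<lambda>_. c"]) simp

lemma poly_fun_const: "poly_fun (\<lambda>_. c)"
  using poly_fun_monomial[of c "\<lambda>_. 0"] by simp

lemma poly_fun_coord: "poly_fun (\<lambda>t. t x y z)"
proof -
  have "(\<Prod>k\<in>UNIV. (case k of (x,y,z) \<Rightarrow> t x y z) ^ (if k = (x,y,z) then 1 else 0)) = t x y z"
    for t :: tensor
    by (subst prod.remove[of _ "(x,y,z)"]) auto
  then show ?thesis using poly_fun_monomial[of 1 "\<lambda>k. if k = (x,y,z) then 1 else 0"] by simp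
qed

lemma poly_fun_add:
  assumes "poly_fun p" "poly_fun q"
  shows "poly_fun (\<lambda>t. p t + q t)"
proof -
  define M :: "(mi \<times> mi \<times> mi \<Rightarrow> nat) \<Rightarrow> tensor \<Rightarrow> complex" where
    "M e t = (\<Prod>k\<in>UNIV. (case k of (x,y,z) \<Rightarrow> t x y z) ^ e k)" for e t
  obtain E c D d where E: "finite E" "p = (\<lambda>t. \<Sum>e\<in>E. c e * M e t)"
    and D: "finite D" "q = (\<lambda>t. \<Sum>e\<in>D. d e * M e t)"
    using assms unfolding poly_fun_def M_def by blast
  define b where "b e = (if e \<in> E then c e else 0) + (if e \<in> D then d e else 0)" for e
  have "(\<Sum>e\<in>E \<union> D. b e * M e t) = p t + q t" for t
  proof -
    have "(\<Sum>e\<in>E \<union> D. b e * M e t)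
        = (\<Sum>e\<in>E \<union> D. if e \<in> E then c e * M e t else 0) + (\<Sum>e\<in>E \<union> D. if e \<in> D then d e * M e t else 0)"
      unfolding sum.distrib[symmetric] by (intro sum.cong) (auto simp: b_def distrib_right)
    also have "\<dots> = p t + q t"
      using E D by (simp add: sum.inter_restrict[symmetric] Int_absorb1 Int_Un_distrib2 Int_absorb2)
    finally show ?thesis .
  qed
  then show ?thesis
    using E(1) D(1) unfolding poly_fun_def M_def[symmetric]
    by (intro exI[of _ "E \<union> D"] exI[of _ b]) auto
qed

lemma poly_fun_sum:
  assumes "\<And>i. i \<in> I \<Longrightarrow> poly_fun (p i)"
  shows "poly_fun (\<lambda>t. \<Sum>i\<in>I. p i t)"
  using assms
proof (induction I rule: infinite_finite_induct)
  case (insert i I)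
  then show ?case using poly_fun_add[of "p i" "\<lambda>t. \<Sum>i\<in>I. p i t"] by simp
qed (simp_all add: poly_fun_const)

lemma poly_fun_mult:
  assumes "poly_fun p" "poly_fun q"
  shows "poly_fun (\<lambda>t. p t * q t)"
proof -
  define M :: "(mi \<times> mi \<times> mi \<Rightarrow> nat) \<Rightarrow> tensor \<Rightarrow> complex" where
    "M e t = (\<Prod>k\<in>UNIV. (case k of (x,y,z) \<Rightarrow> t x y z) ^ e k)" for e t
  obtain E c D d where E: "finite E" "p = (\<lambda>t. \<Sum>e\<in>E. c e * M e t)"
    and D: "finite D" "q = (\<lambda>t. \<Sum>e\<in>D. d e * M e t)"
    using assms unfolding poly_fun_def M_def by blast
  have "M e t * M e' t = M (\<lambda>k. e k + e' k) t" for e e' t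
    by (simp add: M_def power_add prod.distrib)
  then have "(\<lambda>t. p t * q t) = (\<lambda>t. \<Sum>e\<in>E. \<Sum>e'\<in>D. (c e * d e') * M (\<lambda>k. e k + e' k) t)"
    unfolding E(2) D(2) sum_product by (intro ext sum.cong refl) (metis mult.assoc mult.left_commute)
  then show ?thesis
    unfolding M_def by (simp only:) (intro poly_fun_sum poly_fun_monomial)
qed

text \<open>Polynomials are pulled back along the parametrisation \<open>\<Phi>\<close> of tensors
  of rank at most six. Membership of \<open>t\<close> in the closure is what makes evaluation at
  \<open>t\<close> well defined on these pullbacks.\<close>

lemma zariski_closure_apolar:
  assumes t: "t \<in> zariski_closure {s. rank_le s 6}"
  obtains F where "apolar t F"
proof -
  define \<Phi> :: "(nat \<Rightarrow> mi \<Rightarrow> complex) \<times> (nat \<Rightarrow> mi \<Rightarrow> complex) \<times> (nat \<Rightarrow> mi \<Rightarrow> complex) \<Rightarrow> tensor"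
    where "\<Phi> = (\<lambda>(u, v, w) x y z. \<Sum>l<6. u l x * v l y * w l z)"
  have rank: "rank_le s 6 \<longleftrightarrow> s \<in> range \<Phi>" for s
    unfolding rank_le_def \<Phi>_def by (auto simp: image_iff)
  define H0 where "H0 = {(\<lambda>x. p (\<Phi> x), p t) | p. poly_fun p}"
  have H0I: "(\<lambda>x. p (\<Phi> x), p t) \<in> H0" if "poly_fun p" for p using that unfolding H0_def by blast
  have "partial_hom H0"
  proof (rule partial_homI)
    show "(\<lambda>_. c, c) \<in> H0" for c using H0I[OF poly_fun_const[of c]] .
    fix f a g b assume "(f, a) \<in> H0" "(g, b) \<in> H0"
    then obtain p q where "poly_fun p" "f = (\<lambda>x. p (\<Phi> x))" "a = p t"
      "poly_fun q" "g = (\<lambda>x. q (\<Phi> x))" "b = q t" unfolding H0_def by blast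
    then show "(\<lambda>x. f x + g x, a + b) \<in> H0" "(\<lambda>x. f x * g x, a * b) \<in> H0"
      using H0I[OF poly_fun_add[of p q]] H0I[OF poly_fun_mult[of p q]] by simp_all
  next
    fix a assume "(\<lambda>_. 0, a) \<in> H0"
    then obtain p where "poly_fun p" and p0: "(\<lambda>_. 0) = (\<lambda>x. p (\<Phi> x))" and "a = p t"
      unfolding H0_def by blast
    have "p s = 0" if "rank_le s 6" for s
    proof -
      obtain x where "s = \<Phi> x" using \<open>rank_le s 6\<close> rank by blast
      then show ?thesis using fun_cong[OF p0, of x] by simp
    qed
    then show "a = 0" using t \<open>poly_fun p\<close> \<open>a = p t\<close> unfolding zariski_closure_def by blast
  qed
  then obtain H where H: "maximal_hom H" "H0 \<subseteq> H" using maximal_hom_exists by blast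
  have "\<forall>x. \<exists>F. apolar (\<Phi> x) F \<and> (\<forall>c f. f \<in> F \<longrightarrow> (\<lambda>a b. c * f a b) \<in> F)"
  proof
    fix x
    show "\<exists>F. apolar (\<Phi> x) F \<and> (\<forall>c f. f \<in> F \<longrightarrow> (\<lambda>a b. c * f a b) \<in> F)"
      by (rule rank_le_6_apolar[of "\<Phi> x"]) (use rank in auto)
  qed
  from choice[OF this] obtain F where F: "\<And>x. apolar (\<Phi> x) (F x)"
    "\<And>x c f. f \<in> F x \<Longrightarrow> (\<lambda>a b. c * f a b) \<in> F x"
    by blast
  have "(\<lambda>x. \<Phi> x a b z, t a b z) \<in> H" for a b z
    using H(2) H0I[OF poly_fun_coord] by blast
  from limit_apolar[OF H(1) this F] show ?thesis by (rule that)
qed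

section \<open>Torus degeneration\<close>

lemma two_cases: "(x :: 2) = 0 \<or> x = 1"
proof -
  have "card {0, 1 :: 2} = card (UNIV :: 2 set)" by simp
  then have "{0, 1} = (UNIV :: 2 set)" by (intro card_subset_eq) auto
  then show ?thesis by blast
qed

lemma two_add_one: "(x :: 2) + 1 + 1 = x" "x + 1 \<noteq> x" "x \<noteq> x + 1"
  using two_cases[of x] by auto

lemma two_neq_iff: "(x :: 2) \<noteq> y \<longleftrightarrow> y = x + 1"
  using two_cases[of x] two_cases[of y] by auto

text \<open>The weights of the torus on \<open>A \<otimes> B\<close>: \<open>Diag i l\<close> is the weight of both \<open>e\<^sub>i\<^sub>j \<otimes> e\<^sub>j\<^sub>l\<close>, and
  \<open>Off i j l\<close> that of \<open>e\<^sub>i\<^sub>j \<otimes> e\<^sub>k\<^sub>l\<close> with \<open>k = j + 1 \<noteq> j\<close>.\<close>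

datatype slot = Diag 2 2 | Off 2 2 2

fun slot_of :: "mi \<Rightarrow> mi \<Rightarrow> slot" where
  "slot_of (i, j) (k, l) = (if j = k then Diag i l else Off i j l)"

definition bitval :: "2 \<Rightarrow> nat" where "bitval x = (if x = 0 then 0 else 1)"

text \<open>A one-parameter subgroup of the torus that separates the twelve slots.\<close>

fun weight :: "slot \<Rightarrow> nat" where
  "weight (Diag i l) = bitval i + 2 * bitval l + 4"
| "weight (Off i j l) = bitval i + 2 * bitval l + 8 * bitval (j + 1)"

definition weight_left :: "mi \<Rightarrow> nat" where "weight_left a = bitval (fst a) + 4 * bitval (snd a + 1)"
definition weight_right :: "mi \<Rightarrow> nat" where "weight_right b = 4 * bitval (fst b) + 2 * bitval (snd b)"

lemma bitval_simps [simp]: "bitval 0 = 0" "bitval 1 = 1" "bitval 2 = 0" by (simp_all add: bitval_def)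

lemma two_exhaust: obtains "(x :: 2) = 0" | "x = 1" using two_cases by blast

text \<open>The part \<open>4 * bitval (j + 1) + 4 * bitval k\<close> is 4 for \<open>k = j\<close>
  and \<open>8 * bitval (j + 1)\<close> otherwise. Additivity over the factors makes the total
  weight of a triple invariant under \<open>sym_left\<close> or \<open>sym_right\<close>, when the
  new factor is weighted accordingly.\<close>

lemma weight_slot_of: "weight (slot_of a b) = weight_left a + weight_right b"
proof (cases a; cases b)
  fix i j k l assume [simp]: "a = (i, j)" "b = (k, l)"
  show ?thesis
    by (cases j rule: two_exhaust; cases k rule: two_exhaust)
       (simp_all add: weight_left_def weight_right_def)
qed

text \<open>The indices \<open>i\<close> and \<open>l\<close> contribute 0 to 3 and the remaining
  part is 0, 4 or 8, so the twelve slots receive the weights 0 to 11.\<close>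

lemma weight_inj: "weight s = weight s' \<longleftrightarrow> s = s'"
proof -
  have D: "weight s = weight (Diag i l) \<longleftrightarrow> s = Diag i l" for s i l
  proof (cases s)
    case (Diag i' l')
    then show ?thesis
      by (cases i rule: two_exhaust; cases i' rule: two_exhaust;
          cases l rule: two_exhaust; cases l' rule: two_exhaust) simp_all
  next
    case (Off i' j' l')
    then show ?thesis
      by (cases i rule: two_exhaust; cases i' rule: two_exhaust; cases j' rule: two_exhaust;
          cases l rule: two_exhaust; cases l' rule: two_exhaust) simp_all
  qed
  have O: "weight (Off i j l) = weight (Off i' j' l') \<longleftrightarrow> Off i j l = Off i' j' l'" for i j l i' j' l'
    by (cases i rule: two_exhaust; cases i' rule: two_exhaust; cases j rule: two_exhaust;
        cases j' rule: two_exhaust; cases l rule: two_exhaust; cases l' rule: two_exhaust) simp_all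
  show ?thesis
  proof (cases s)
    case (Diag i l)
    then show ?thesis using D[of s' i l] by auto
  next
    case (Off i j l)
    then show ?thesis using O[of i j l] D[of s] by (cases s') auto
  qed
qed

text \<open>The constraints on the zero set \<open>Z\<close> of a weight vector whose slices lie in the span of the
  slices of the tensor and of all coordinate vectors in the slots of \<open>S\<close>. In a slot \<open>Diag i l\<close> outside
  \<open>S\<close> the two coordinates are proportional with nonzero factor.\<close>

definition vanishing_pattern :: "slot set \<Rightarrow> (mi \<times> mi \<times> mi \<Rightarrow> bool) \<Rightarrow> bool" where
  "vanishing_pattern S Z \<longleftrightarrow>
     (\<forall>p i j l. Off i j l \<notin> S \<longrightarrow> Z (p, (i, j), (j + 1, l))) \<and>
     (\<forall>p i j l. Diag i l \<notin> S \<longrightarrow> Z (p, (i, j), (j, l)) \<longrightarrow> Z (p, (i, j + 1), (j + 1, l)))"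

section \<open>Zero patterns determined by five coordinates\<close>

fun flip_row :: "slot \<Rightarrow> slot" where
  "flip_row (Diag i l) = Diag (i + 1) l"
| "flip_row (Off i j l) = Off (i + 1) j l"

text \<open>Zeros at these two coordinates per slot of \<open>S\<close> settle the triples whose two
  row indices agree.\<close>

fun base_coords :: "slot \<Rightarrow> (mi \<times> mi \<times> mi) set" where
  "base_coords (Diag i l) = {((i, 0), (i, 0), (0, l)), ((i, 1), (i, 1), (1, l))}"
| "base_coords (Off i j l) = {((i, j), (i, j), (j + 1, l)), ((i, j), (i, j + 1), (j + 1, l))}"

lemma finite_slots: "finite (S :: slot set)"
proof -
  have "(UNIV :: slot set) = (\<lambda>(i, l). Diag i l) ` UNIV \<union> (\<lambda>(i, j, l). Off i j l) ` UNIV"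
  proof -
    have "s \<in> (\<lambda>(i, l). Diag i l) ` UNIV \<union> (\<lambda>(i, j, l). Off i j l) ` UNIV" for s
      by (cases s) (auto simp: image_iff)
    then show ?thesis by blast
  qed
  moreover have "finite \<dots>" by simp
  ultimately have "finite (UNIV :: slot set)" by (simp only:)
  then show ?thesis by (rule rev_finite_subset) simp
qed

text \<open>By symmetry a triple \<open>(p, a, b)\<close> is constrained through the slots of both
  \<open>(a, b)\<close> and \<open>(p, b)\<close>. Two slots yield at most four base coordinates,
  which settle equal row indices. For distinct row indices the assumption on \<open>flip_row\<close>
  leaves at most one linked class of triples free, and a fifth coordinate \<open>r\<close> settles
  it.\<close>

lemma pattern_determined:
  assumes card: "card S \<le> 2" and flip: "\<And>s. s \<in> S \<Longrightarrow> flip_row s \<notin> S"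
  shows "\<exists>R. card R \<le> 5 \<and>
    (\<forall>Z. vanishing_pattern S Z \<longrightarrow> (\<forall>x. Z x \<longrightarrow> Z (sym_left x)) \<longrightarrow> (\<forall>x\<in>R. Z x) \<longrightarrow> (\<forall>x. Z x))"
proof -
  \<comment> \<open>Something can escape the base coordinates only if \<open>S\<close> consists of a
    diagonal and an off-diagonal slot with the same \<open>l\<close>; in all other cases
    \<open>r\<close> is arbitrary.\<close>
  have ex_r: "\<exists>r. \<forall>x y j l. Diag x l \<in> S \<longrightarrow> Off y j l \<in> S \<longrightarrow>
      r = (if x = y then ((x, j), (x + 1, j), (j, l)) else ((y, j), (x, j + 1), (j + 1, l)))"
  proof (cases "\<exists>x y j l. Diag x l \<in> S \<and> Off y j l \<in> S")
    case True
    then obtain x y j l where mem: "Diag x l \<in> S" "Off y j l \<in> S" by blast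
    have "S = {Diag x l, Off y j l}"
      using mem card by (intro card_seteq[OF finite_slots, symmetric]) auto
    then show ?thesis by auto
  qed blast
  then obtain r where r: "\<And>x y j l. Diag x l \<in> S \<Longrightarrow> Off y j l \<in> S \<Longrightarrow>
      r = (if x = y then ((x, j), (x + 1, j), (j, l)) else ((y, j), (x, j + 1), (j + 1, l)))"
    by blast
  define R where "R = insert r (\<Union>s\<in>S. base_coords s)"
  have "card (base_coords s) \<le> 2" for s by (cases s) (simp_all add: card_insert_le_m1)
  then have "(\<Sum>s\<in>S. card (base_coords s)) \<le> card S * 2"
    using sum_bounded_above[of S "\<lambda>s. card (base_coords s)" 2] by simp
  then have "card (\<Union>s\<in>S. base_coords s) \<le> 4"
    using card_UN_le[OF finite_slots[of S], of base_coords] card by linarith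
  moreover have "finite (\<Union>s\<in>S. base_coords s)" by simp
  ultimately have cardR: "card R \<le> 5" unfolding R_def by (simp add: card_insert_if)
  have "Z x" if pat: "vanishing_pattern S Z" and sym: "\<And>x. Z x \<Longrightarrow> Z (sym_left x)"
    and R: "\<And>x. x \<in> R \<Longrightarrow> Z x" for Z x
  proof -
    have swap: "Z (p, a, b) \<Longrightarrow> Z (a, p, b)" for p a b using sym[of "(p, a, b)"] by (simp add: sym_left_def)
    have base: "Z x" if "s \<in> S" "x \<in> base_coords s" for s x using that R unfolding R_def by blast
    have off: "Z (p, (i, j), (j + 1, l))" if "Off i j l \<notin> S" for p i j l
      using pat that unfolding vanishing_pattern_def by blast
    have link: "Z (p, (i, j), (j, l)) \<longleftrightarrow> Z (p, (i, j + 1), (j + 1, l))" if "Diag i l \<notin> S" for p i j l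
      using pat that two_add_one(1)[of j] unfolding vanishing_pattern_def by metis
    \<comment> \<open>Triples are sorted by their inner indices: in \<open>A\<close> both agree with
      the row of \<open>b\<close>, in \<open>C\<close> and its swap exactly one does, in
      \<open>B\<close> below neither. Diagonal slots outside \<open>S\<close> link \<open>A\<close>
      to \<open>C\<close>.\<close>
    define A where "A i i' j l \<longleftrightarrow> Z ((i, j), (i', j), (j, l))" for i i' j l
    define C where "C i i' j l \<longleftrightarrow> Z ((i, j), (i', j + 1), (j + 1, l))" for i i' j l
    have A_sym: "A i i' j l \<longleftrightarrow> A i' i j l" for i i' j l unfolding A_def using swap by blast
    have C_off: "C i i' j l" if "Off i j l \<notin> S" for i i' j l
      unfolding C_def by (rule swap) (rule off[OF that])
    have A_C: "A i i' j l \<longleftrightarrow> C i i' j l" if "Diag i' l \<notin> S" for i i' j l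
      unfolding A_def C_def by (rule link[OF that])
    have A_base: "A i i j l" if "Diag i l \<in> S" for i j l
      unfolding A_def by (rule base[OF that]) (cases j rule: two_exhaust; simp)
    have C_base: "C i i j l" if "Off i j l \<in> S" for i j l
      unfolding C_def by (rule base[OF that]) simp
    have flipD: "Diag i l \<in> S \<Longrightarrow> Diag (i + 1) l \<notin> S" for i l using flip[of "Diag i l"] by simp
    have flipO: "Off i j l \<in> S \<Longrightarrow> Off (i + 1) j l \<notin> S" for i j l using flip[of "Off i j l"] by simp
    have same: "A i i j l \<and> C i i j l" for i j l
      using A_base C_base A_C C_off by blast
    have r_A: "A i (i + 1) j l" if "Diag i l \<in> S" "Off i j l \<in> S" for i j l
    proof -
      have "((i, j), (i + 1, j), (j, l)) \<in> R" using r[OF that] by (simp add: R_def)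
      then show ?thesis unfolding A_def by (rule R)
    qed
    have r_C: "C (i + 1) i j l" if "Diag i l \<in> S" "Off (i + 1) j l \<in> S" for i j l
    proof -
      have "((i + 1, j), (i, j + 1), (j + 1, l)) \<in> R"
        using r[OF that] two_add_one(3)[of i] by (simp add: R_def)
      then show ?thesis unfolding C_def by (rule R)
    qed
    \<comment> \<open>Of the two \<open>Diag\<close> slots in rows \<open>i\<close> and
      \<open>i + 1\<close> at most one lies in \<open>S\<close>, and likewise for the
      \<open>Off\<close> slots. The links and zeros from the others settle every case except the one
      covered by \<open>r\<close>.\<close>
    have diff: "A i (i + 1) j l \<and> C i (i + 1) j l" for i j l
    proof -
      note [simp] = two_add_one(1)
      note facts = A_sym[of i "i + 1" j l] C_off[of i j l "i + 1"] C_off[of "i + 1" j l i]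
        A_C[of i l "i + 1" j] A_C[of "i + 1" l i j] flipD[of i l] flipO[of i j l]
        r_A[of i l j] r_A[of "i + 1" l j] r_C[of i l j] r_C[of "i + 1" l j]
      show ?thesis using facts by (simp only: two_add_one(1)) blast
    qed
    have AC: "A i i' j l \<and> C i i' j l" for i i' j l
      using same diff two_neq_iff[of i i'] by (cases "i = i'") auto
    \<comment> \<open>If both \<open>Off\<close> slots lie in \<open>S\<close> the rows agree and a
      base coordinate applies; otherwise a slot outside \<open>S\<close> forces the zero.\<close>
    have B: "Z ((i, j), (i', j), (j + 1, l))" for i i' j l
    proof (cases "Off i' j l \<in> S \<and> Off i j l \<in> S")
      case True
      then have "i = i'" using flipO[of i j l] two_neq_iff[of i i'] by metis
      then show ?thesis using base[of "Off i j l"] True by simp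
    next
      case False
      then show ?thesis using off swap by blast
    qed
    obtain i j i' j' k l where x: "x = ((i, j), (i', j'), (k, l))" by (metis prod.exhaust)
    consider "j = j'" "k = j'" | "j = j'" "k = j' + 1" | "j = j' + 1" "k = j' + 1" | "j' = j + 1" "k = j'"
      using two_neq_iff[of j' k] two_neq_iff[of j' j] two_neq_iff[of j j'] by blast
    then show ?thesis
    proof cases
      case 1
      then show ?thesis using AC[of i i' j l] x by (simp add: A_def)
    next
      case 2
      then show ?thesis using B x by simp
    next
      case 3
      then show ?thesis using AC[of i' i j' l] x swap by (simp add: C_def)
    next
      case 4
      then show ?thesis using AC[of i i' j l] x by (simp add: C_def)
    qed
  qed
  then show ?thesis using cardR by blast
qed

section \<open>Lowest-weight parts of an apolar space\<close>

definition tau :: "tensor \<Rightarrow> mi \<Rightarrow> mi \<Rightarrow> complex" where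
  "tau t a b = t a b (snd b, fst a)"

text \<open>The slots in which the initial degeneration of \<open>F\<close> is larger than the span of the slices of
  \<open>t\<close>.\<close>

definition extra_slots :: "tensor \<Rightarrow> (mi \<Rightarrow> mi \<Rightarrow> complex) set \<Rightarrow> slot set" where
  "extra_slots t F = {s. \<exists>f\<in>F. (\<forall>a b. weight (slot_of a b) < weight s \<longrightarrow> f a b = 0) \<and>
     (\<nexists>c. \<forall>a b. slot_of a b = s \<longrightarrow> f a b = c * tau t a b)}"

lemma support_mamu222:
  assumes "tsupport t = tsupport mamu222"
  shows "t (i, j) (k, l) (m, n) \<noteq> 0 \<longleftrightarrow> j = k \<and> l = m \<and> n = i"
proof -
  have "((i, j), (k, l), (m, n)) \<in> tsupport t \<longleftrightarrow> ((i, j), (k, l), (m, n)) \<in> tsupport mamu222"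
    using assms by simp
  then show ?thesis by (auto simp: tsupport_def mamu222_def split: if_splits)
qed

text \<open>The support forces the third index to be \<open>(snd b, fst a)\<close>. Hence the slice
  at \<open>(l, i)\<close> lives on the slot \<open>Diag i l\<close>, and \<open>tau\<close> gathers
  all four slices without overlap.\<close>

lemma sum_slices_eq_tau:
  assumes supp: "tsupport t = tsupport mamu222"
  shows "(\<Sum>z\<in>UNIV. d z * t a b z) = d (snd b, fst a) * tau t a b"
proof -
  have "t a b z = 0" if "z \<noteq> (snd b, fst a)" for z
    using support_mamu222[OF supp, of "fst a" "snd a" "fst b" "snd b" "fst z" "snd z"] that
    by (auto simp: prod_eq_iff)
  then have "(\<Sum>z\<in>UNIV. d z * t a b z) = (\<Sum>z\<in>UNIV. if z = (snd b, fst a) then d z * t a b z else 0)"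
    by (intro sum.cong refl) simp
  then show ?thesis by (simp add: tau_def)
qed

lemma slot_of_outer:
  assumes "slot_of a b = slot_of a' b'"
  shows "(snd b, fst a) = (snd b', fst a')"
  using assms by (cases a; cases b; cases a'; cases b') (auto split: if_splits)

text \<open>Three extra slots would give three members of \<open>F\<close> with distinct leading
  slots; together with the four slices they would be independent, against the dimension
  bound.\<close>

lemma card_extra_slots:
  assumes supp: "tsupport t = tsupport mamu222" and F: "apolar t F"
  shows "card (extra_slots t F) \<le> 2"
proof (rule ccontr)
  assume "\<not> ?thesis"
  then have "card (UNIV :: 3 set) \<le> card (extra_slots t F)" by simp
  then obtain \<sigma> :: "3 \<Rightarrow> slot" where \<sigma>: "range \<sigma> \<subseteq> extra_slots t F" "inj \<sigma>"
    using card_le_inj[OF finite_class.finite_UNIV finite_slots] by blast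
  then have "\<forall>k. \<exists>f. f \<in> F \<and> (\<forall>a b. weight (slot_of a b) < weight (\<sigma> k) \<longrightarrow> f a b = 0) \<and>
     (\<nexists>c. \<forall>a b. slot_of a b = \<sigma> k \<longrightarrow> f a b = c * tau t a b)"
    unfolding extra_slots_def by blast
  from choice[OF this] obtain f :: "3 \<Rightarrow> mi \<Rightarrow> mi \<Rightarrow> complex" where
    f: "\<And>k. f k \<in> F" "\<And>k a b. weight (slot_of a b) < weight (\<sigma> k) \<Longrightarrow> f k a b = 0"
    "\<And>k. \<nexists>c. \<forall>a b. slot_of a b = \<sigma> k \<longrightarrow> f k a b = c * tau t a b"
    by blast
  have "\<forall>f :: 3 \<Rightarrow> mi \<Rightarrow> mi \<Rightarrow> complex. (\<forall>k. f k \<in> F) \<longrightarrow>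
        (\<exists>c :: 3 + mi \<Rightarrow> complex. (\<exists>i. c i \<noteq> 0) \<and>
          (\<forall>a b. (\<Sum>k\<in>UNIV. c (Inl k) * f k a b) + (\<Sum>z\<in>UNIV. c (Inr z) * t a b z) = 0))"
    using F unfolding apolar_def by (elim conjE)
  from this[rule_format, of f, OF f(1)] obtain c :: "3 + mi \<Rightarrow> complex" where c: "\<exists>i. c i \<noteq> 0"
    "\<And>a b. (\<Sum>k\<in>UNIV. c (Inl k) * f k a b) + c (Inr (snd b, fst a)) * tau t a b = 0"
    unfolding sum_slices_eq_tau[OF supp, of "\<lambda>z. _ (Inr z)"] by blast
  have zero: "c (Inl k) = 0" for k
  proof (rule ccontr)
    assume "c (Inl k) \<noteq> 0"
    \<comment> \<open>Of the members with nonzero coefficient the one with the lowest slot is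
      singled out. The others vanish on that slot, so the relation would make it a multiple of
      \<open>tau\<close> there.\<close>
    define K where "K = {k. c (Inl k) \<noteq> 0}"
    have "finite K" "K \<noteq> {}" using \<open>c (Inl k) \<noteq> 0\<close> unfolding K_def by auto
    then obtain k0 where k0: "k0 \<in> K" "\<And>k. k \<in> K \<Longrightarrow> weight (\<sigma> k0) \<le> weight (\<sigma> k)"
      using arg_min_if_finite[of K "\<lambda>k. weight (\<sigma> k)"] by (metis not_le_imp_less)
    have others: "c (Inl k) * f k a b = 0" if "k \<noteq> k0" "slot_of a b = \<sigma> k0" for k a b
    proof (cases "k \<in> K")
      case True
      have "weight (\<sigma> k0) \<noteq> weight (\<sigma> k)"
        using \<open>k \<noteq> k0\<close> \<sigma>(2) by (auto simp: weight_inj inj_eq)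
      then show ?thesis using f(2)[of a b k] k0(2)[OF True] that(2) by simp
    qed (simp add: K_def)
    \<comment> \<open>The slot is nonempty, as otherwise every scalar would fit. The outer indices
      are constant on it, so a single scalar serves the whole slot.\<close>
    obtain a0 b0 where ab0: "slot_of a0 b0 = \<sigma> k0" using f(3)[of k0] by (metis mult_zero_left)
    have "f k0 a b = - c (Inr (snd b0, fst a0)) / c (Inl k0) * tau t a b" if "slot_of a b = \<sigma> k0" for a b
    proof -
      have "(\<Sum>k\<in>UNIV. c (Inl k) * f k a b) = c (Inl k0) * f k0 a b"
      proof -
        have "(\<Sum>k\<in>UNIV - {k0}. c (Inl k) * f k a b) = 0"
          by (intro sum.neutral ballI others[OF _ that]) simp
        then show ?thesis by (subst sum.remove[of _ k0]) simp_all
      qed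
      then have "c (Inl k0) * f k0 a b + c (Inr (snd b0, fst a0)) * tau t a b = 0"
        using c(2)[of a b] slot_of_outer[of a b a0 b0] that ab0 by simp
      then show ?thesis using k0(1) unfolding K_def
        by (simp add: field_simps eq_neg_iff_add_eq_0)
    qed
    then show False using f(3)[of k0] by blast
  qed
  have "c (Inr z) = 0" for z
  proof -
    obtain m n where z: "z = (m, n)" by (cases z)
    have "tau t (n, 0) (0, m) \<noteq> 0"
      using support_mamu222[OF supp, of n 0 0 m m n] by (simp add: tau_def)
    then show ?thesis using c(2)[of "(n, 0)" "(0, m)"] zero z by simp
  qed
  then have "c i = 0" for i using zero by (cases i) auto
  then show False using c(1) by blast
qed

text \<open>\<open>Z\<close> is the zero set of the part of lowest weight of \<open>g\<close>.\<close>

lemma lowest_part_pattern: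
  fixes g :: "mi \<times> mi \<times> mi \<Rightarrow> complex" and w :: "mi \<Rightarrow> nat"
  assumes supp: "tsupport t = tsupport mamu222"
    and nz: "\<exists>x. g x \<noteq> 0" and slices: "\<And>p. (\<lambda>a b. g (p, a, b)) \<in> F"
    and sym: "\<And>x. g (\<pi> x) = g x"
    and W: "\<And>p a b. W (p, a, b) = w p + weight (slot_of a b)" "\<And>x. W (\<pi> x) = W x"
  obtains Z where "vanishing_pattern (extra_slots t F) Z" "\<exists>x. \<not> Z x" "\<And>x. g x = 0 \<Longrightarrow> Z x"
    "\<And>x. Z x \<Longrightarrow> Z (\<pi> x)"
proof -
  define m where "m = (LEAST n. \<exists>x. g x \<noteq> 0 \<and> W x = n)"
  have "\<exists>n x. g x \<noteq> 0 \<and> W x = n" using nz by blast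
  then have m: "\<exists>x. g x \<noteq> 0 \<and> W x = m" unfolding m_def by (rule LeastI_ex)
  have below: "g x = 0" if "W x < m" for x
    using not_less_Least[of "W x" "\<lambda>n. \<exists>x. g x \<noteq> 0 \<and> W x = n"] that unfolding m_def by blast
  \<comment> \<open>Outside weight \<open>m\<close> the lowest part has no coefficients, so
    \<open>Z\<close> holds there automatically.\<close>
  define Z where "Z x \<longleftrightarrow> (W x = m \<longrightarrow> g x = 0)" for x
  \<comment> \<open>The slice of \<open>g\<close> at \<open>p\<close> vanishes on all slots lighter
    than \<open>s\<close>; if \<open>s\<close> is not extra, its part on \<open>s\<close> must be a
    multiple of \<open>tau\<close>.\<close>
  have part: "\<exists>c. \<forall>a b. slot_of a b = s \<longrightarrow> g (p, a, b) = c * tau t a b"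
    if "s \<notin> extra_slots t F" "w p + weight s = m" for s p
  proof -
    have "\<forall>a b. weight (slot_of a b) < weight s \<longrightarrow> g (p, a, b) = 0"
      using that(2) by (intro allI impI below) (simp add: W(1))
    moreover have "\<not> ((\<forall>a b. weight (slot_of a b) < weight s \<longrightarrow> f a b = 0) \<and>
        (\<nexists>c. \<forall>a b. slot_of a b = s \<longrightarrow> f a b = c * tau t a b))" if "f \<in> F" for f
      using \<open>s \<notin> extra_slots t F\<close> \<open>f \<in> F\<close> unfolding extra_slots_def by blast
    from this[OF slices[of p]]
    have "\<not> ((\<forall>a b. weight (slot_of a b) < weight s \<longrightarrow> g (p, a, b) = 0) \<and>
        (\<nexists>c. \<forall>a b. slot_of a b = s \<longrightarrow> g (p, a, b) = c * tau t a b))" .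
    ultimately show ?thesis by blast
  qed
  have "vanishing_pattern (extra_slots t F) Z"
    unfolding vanishing_pattern_def
  proof (intro conjI allI impI)
    fix p i j l assume "Off i j l \<notin> extra_slots t F"
    moreover have slot: "slot_of (i, j) (j + 1, l) = Off i j l" by (simp add: two_add_one)
    moreover have "tau t (i, j) (j + 1, l) = 0"
      using support_mamu222[OF supp, of i j "j + 1" l l i] by (simp add: tau_def two_add_one)
    ultimately show "Z (p, (i, j), (j + 1, l))"
      unfolding Z_def W(1) using part[of "Off i j l" p] by (metis mult_zero_right)
  next
    fix p i j l assume S: "Diag i l \<notin> extra_slots t F" and Z: "Z (p, (i, j), (j, l))"
    have slot: "slot_of (i, k) (k, l) = Diag i l" for k by simp
    have tau: "tau t (i, j) (j, l) \<noteq> 0"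
      using support_mamu222[OF supp, of i j j l l i] by (simp add: tau_def)
    show "Z (p, (i, j + 1), (j + 1, l))"
      unfolding Z_def W(1) slot
    proof
      assume wm: "w p + weight (Diag i l) = m"
      then obtain c where c: "\<And>a b. slot_of a b = Diag i l \<Longrightarrow> g (p, a, b) = c * tau t a b"
        using part[OF S] by blast
      have "g (p, (i, j), (j, l)) = 0" using Z wm unfolding Z_def W(1) slot by blast
      then have "c = 0" using c[OF slot, of j] tau by simp
      then show "g (p, (i, j + 1), (j + 1, l)) = 0" using c[OF slot, of "j + 1"] by simp
    qed
  qed
  moreover have "\<exists>x. \<not> Z x" using m unfolding Z_def by blast
  moreover have "Z x" if "g x = 0" for x using that unfolding Z_def by blast
  moreover have "Z (\<pi> x)" if "Z x" for x using that unfolding Z_def W(2) sym .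
  ultimately show ?thesis using that by blast
qed

section \<open>Transposition and the contradiction\<close>

fun transpose_slot :: "slot \<Rightarrow> slot" where
  "transpose_slot (Diag i l) = Diag l i"
| "transpose_slot (Off i j l) = Off l (j + 1) i"

lemma transpose_slot_twice: "transpose_slot (transpose_slot s) = s"
  by (cases s) (simp_all only: transpose_slot.simps two_add_one)

lemma transpose_slot_image_iff: "s \<in> transpose_slot ` S \<longleftrightarrow> transpose_slot s \<in> S"
  by (metis image_iff transpose_slot_twice)

definition transpose_triple :: "mi \<times> mi \<times> mi \<Rightarrow> mi \<times> mi \<times> mi" where
  "transpose_triple = (\<lambda>(p, a, b). (prod.swap p, prod.swap b, prod.swap a))"

lemma transpose_triple_twice: "transpose_triple (transpose_triple x) = x"
  by (cases x) (simp add: transpose_triple_def)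

text \<open>Transposition sends e_ij (x) e_kl to e_lk (x) e_ji and interchanges
  \<open>sym_left\<close> with \<open>sym_right\<close>, so that \<open>pattern_determined\<close>
  serves both symmetry conditions.\<close>

lemma pattern_transpose:
  assumes "vanishing_pattern S Z"
  shows "vanishing_pattern (transpose_slot ` S) (Z \<circ> transpose_triple)"
proof -
  have off: "Off i j l \<notin> S \<Longrightarrow> Z (p, (i, j), (j + 1, l))"
    and diag: "Diag i l \<notin> S \<Longrightarrow> Z (p, (i, j), (j, l)) \<Longrightarrow> Z (p, (i, j + 1), (j + 1, l))" for p i j l
    using assms unfolding vanishing_pattern_def by blast+
  show ?thesis
    unfolding vanishing_pattern_def transpose_slot_image_iff
  proof (intro conjI allI impI)
    fix p i j l assume "transpose_slot (Off i j l) \<notin> S"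
    then show "(Z \<circ> transpose_triple) (p, (i, j), (j + 1, l))"
      using off[of l "j + 1" i "prod.swap p"] by (simp add: transpose_triple_def two_add_one)
  next
    fix p i j l assume "transpose_slot (Diag i l) \<notin> S" "(Z \<circ> transpose_triple) (p, (i, j), (j, l))"
    then show "(Z \<circ> transpose_triple) (p, (i, j + 1), (j + 1, l))"
      using diag[of l i "prod.swap p" j] by (simp add: transpose_triple_def)
  qed
qed

text \<open>The condition for \<open>sym_left\<close> forces two slots of \<open>S\<close> differing
  only in the row index, that for \<open>sym_right\<close> two differing only in the column index. A
  set of at most two slots cannot contain both pairs.\<close>

lemma not_apolar:
  assumes supp: "tsupport t = tsupport mamu222"
  shows "\<not> apolar t F"
proof
  assume F: "apolar t F"
  define S where "S = extra_slots t F"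
  have card: "card S \<le> 2" unfolding S_def by (rule card_extra_slots[OF supp F])
  have row: "\<exists>s\<in>S. flip_row s \<in> S"
  proof (rule ccontr)
    assume contra: "\<not> ?thesis"
    have "\<And>s. s \<in> S \<Longrightarrow> flip_row s \<notin> S" using contra by blast
    from pattern_determined[OF card this] obtain R where R: "card R \<le> 5"
      "\<forall>Z. vanishing_pattern S Z \<longrightarrow> (\<forall>x. Z x \<longrightarrow> Z (sym_left x)) \<longrightarrow> (\<forall>x\<in>R. Z x) \<longrightarrow> (\<forall>x. Z x)" by blast
    have "ample F sym_left" using F unfolding apolar_def by (elim conjE)
    from this[unfolded ample_def, rule_format, OF R(1)]
    obtain g where g: "\<exists>x. g x \<noteq> 0" "\<And>x. x \<in> R \<Longrightarrow> g x = 0" "\<And>x. g (sym_left x) = g x"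
      "\<And>p. (\<lambda>a b. g (p, a, b)) \<in> F" by blast
    define W where "W = (\<lambda>(p, a, b). weight_left p + weight (slot_of a b))"
    obtain Z where Z: "vanishing_pattern S Z" "\<exists>x. \<not> Z x" "\<And>x. g x = 0 \<Longrightarrow> Z x" "\<And>x. Z x \<Longrightarrow> Z (sym_left x)"
      unfolding S_def
      by (rule lowest_part_pattern[OF supp g(1,4,3), of W weight_left])
         (auto simp: W_def sym_left_def weight_slot_of)
    have "Z x" for x by (rule R(2)[rule_format, OF Z(1)]) (use Z(3,4) g(2) in blast)+
    then show False using Z(2) by blast
  qed
  have column: "\<exists>s\<in>transpose_slot ` S. flip_row s \<in> transpose_slot ` S"
  proof (rule ccontr)
    assume contra: "\<not> ?thesis"
    have card': "card (transpose_slot ` S) \<le> 2"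
      using card card_image_le[OF finite_slots, of transpose_slot S] by linarith
    have "\<And>s. s \<in> transpose_slot ` S \<Longrightarrow> flip_row s \<notin> transpose_slot ` S" using contra by blast
    from pattern_determined[OF card' this] obtain R where R: "card R \<le> 5"
      "\<forall>Z. vanishing_pattern (transpose_slot ` S) Z \<longrightarrow> (\<forall>x. Z x \<longrightarrow> Z (sym_left x)) \<longrightarrow>
         (\<forall>x\<in>R. Z x) \<longrightarrow> (\<forall>x. Z x)" by blast
    have "card (transpose_triple ` R) \<le> 5" using card_image_le[OF finite, of transpose_triple R] R(1) by linarith
    moreover have "ample F sym_right" using F unfolding apolar_def by (elim conjE)
    ultimately obtain g where g: "\<exists>x. g x \<noteq> 0" "\<And>x. x \<in> transpose_triple ` R \<Longrightarrow> g x = 0"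
      "\<And>x. g (sym_right x) = g x" "\<And>p. (\<lambda>a b. g (p, a, b)) \<in> F"
      unfolding ample_def by (elim allE[of _ "transpose_triple ` R"]) blast
    define W where "W = (\<lambda>(p, a, b). weight_right p + weight (slot_of a b))"
    obtain Z where Z: "vanishing_pattern S Z" "\<exists>x. \<not> Z x" "\<And>x. g x = 0 \<Longrightarrow> Z x" "\<And>x. Z x \<Longrightarrow> Z (sym_right x)"
      unfolding S_def
      by (rule lowest_part_pattern[OF supp g(1,4,3), of W weight_right])
         (auto simp: W_def sym_right_def weight_slot_of)
    have "sym_right (transpose_triple x) = transpose_triple (sym_left x)" for x
      by (cases x) (simp add: sym_right_def sym_left_def transpose_triple_def)
    then have "(Z \<circ> transpose_triple) x \<Longrightarrow> (Z \<circ> transpose_triple) (sym_left x)" for x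
      using Z(4)[of "transpose_triple x"] by simp
    moreover have "(Z \<circ> transpose_triple) x" if "x \<in> R" for x
      using g(2)[of "transpose_triple x"] Z(3) that by simp
    ultimately have "(Z \<circ> transpose_triple) x" for x
      using R(2) pattern_transpose[OF Z(1)] by blast
    from this[of "transpose_triple _"] have "Z x" for x by (simp add: transpose_triple_twice)
    then show False using Z(2) by blast
  qed
  obtain s where s: "s \<in> S" "flip_row s \<in> S" using row by blast
  obtain s' where s': "transpose_slot s' \<in> S" "transpose_slot (flip_row s') \<in> S"
    using column unfolding Bex_def transpose_slot_image_iff by blast
  have "s \<noteq> flip_row s" by (cases s) (simp_all add: two_add_one)
  then have S: "S = {s, flip_row s}"
    using s card by (intro card_seteq[OF finite_slots, symmetric]) auto
  \<comment> \<open>All members of \<open>S\<close> now share their last index, while the two slots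
    from \<open>s'\<close> differ in it.\<close>
  show False using s' unfolding S
    by (cases s; cases s') (auto simp: two_add_one)
qed

section \<open>Border rank\<close>

lemma rank_le_mono:
  assumes "rank_le t r" "r \<le> s"
  shows "rank_le t s"
proof -
  obtain u v w :: "nat \<Rightarrow> mi \<Rightarrow> complex" where t: "t = (\<lambda>x y z. \<Sum>l<r. u l x * v l y * w l z)"
    using assms(1) unfolding rank_le_def by blast
  have "(\<Sum>l<r. u l x * v l y * w l z) = (\<Sum>l<s. (if l < r then u l x else 0) * v l y * w l z)" for x y z
    using assms(2) by (intro sum.mono_neutral_cong_left) auto
  then show ?thesis unfolding rank_le_def t
    by (intro exI[of _ "\<lambda>l x. if l < r then u l x else 0"] exI[of _ v] exI[of _ w]) simp
qed

lemma zariski_closure_mono: "S \<subseteq> T \<Longrightarrow> zariski_closure S \<subseteq> zariski_closure T"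
  unfolding zariski_closure_def by blast

lemma subset_zariski_closure: "S \<subseteq> zariski_closure S"
  unfolding zariski_closure_def by blast

text \<open>Expansion in the first two factors gives sixteen terms. This ensures that the minimum
  defining \<open>border_rank\<close> is attained.\<close>

lemma rank_le_16: "rank_le t 16"
proof -
  have "card (UNIV :: (mi \<times> mi) set) = 16" by simp
  then obtain h :: "nat \<Rightarrow> mi \<times> mi" where h: "bij_betw h {0..<16} UNIV"
    using ex_bij_betw_nat_finite[OF finite_class.finite_UNIV, where 'a1 = "mi \<times> mi"] by metis
  have "t x y z = (\<Sum>l<16. (if x = fst (h l) then 1 else 0) * (if y = snd (h l) then 1 else 0)
      * t (fst (h l)) (snd (h l)) z)" for x y z
  proof -
    have "(\<Sum>l<16. (if x = fst (h l) then 1 else 0) * (if y = snd (h l) then 1 else 0)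
        * t (fst (h l)) (snd (h l)) z) = (\<Sum>l<16. if h l = (x, y) then t x y z else 0)"
    proof (intro sum.cong refl)
      fix l
      show "(if x = fst (h l) then 1 else 0) * (if y = snd (h l) then 1 else 0) * t (fst (h l)) (snd (h l)) z
          = (if h l = (x, y) then t x y z else 0)"
        by (cases "h l") auto
    qed
    also have "\<dots> = (\<Sum>p\<in>UNIV. if p = (x, y) then t x y z else 0)"
      using sum.reindex_bij_betw[OF h, of "\<lambda>p. if p = (x, y) then t x y z else 0"]
      by (simp only: atLeast0LessThan)
    finally show ?thesis by simp
  qed
  then have "t = (\<lambda>x y z. \<Sum>l<16. (if x = fst (h l) then 1 else 0) * (if y = snd (h l) then 1 else 0)
      * t (fst (h l)) (snd (h l)) z)" by blast
  then show ?thesis unfolding rank_le_def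
    by (intro exI[of _ "\<lambda>l x. if x = fst (h l) then 1 else 0"]
        exI[of _ "\<lambda>l y. if y = snd (h l) then 1 else 0"] exI[of _ "\<lambda>l z. t (fst (h l)) (snd (h l)) z"])
qed

section \<open>Strassen's algorithm and the two bounds\<close>

definition mat2 :: "complex \<Rightarrow> complex \<Rightarrow> complex \<Rightarrow> complex \<Rightarrow> mi \<Rightarrow> complex" where
  "mat2 p q r s = (\<lambda>(i, j). if i = 0 then if j = 0 then p else q else if j = 0 then r else s)"

lemma mat2_simps [simp]:
  "mat2 p q r s (0, 0) = p" "mat2 p q r s (0, 1) = q"
  "mat2 p q r s (1, 0) = r" "mat2 p q r s (1, 1) = s"
  by (simp_all add: mat2_def)

lemma rank_le_mamu222: "rank_le mamu222 7"
proof -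
  \<comment> \<open>Strassen's algorithm; the third factors are transposed, as \<open>mamu222\<close> is the trace form.\<close>
  define u where "u l = [mat2 1 0 0 1, mat2 0 0 1 1, mat2 1 0 0 0, mat2 0 0 0 1,
    mat2 1 1 0 0, mat2 (-1) 0 1 0, mat2 0 1 0 (-1)] ! l" for l
  define v where "v l = [mat2 1 0 0 1, mat2 1 0 0 0, mat2 0 1 0 (-1), mat2 (-1) 0 1 0,
    mat2 0 0 0 1, mat2 1 1 0 0, mat2 0 0 1 1] ! l" for l
  define w where "w l = [mat2 1 0 0 1, mat2 0 1 0 (-1), mat2 0 0 1 1, mat2 1 1 0 0,
    mat2 (-1) 0 1 0, mat2 0 0 0 1, mat2 1 0 0 0] ! l" for l
  have sum7: "(\<Sum>r<7. f r) = f 0 + f 1 + f 2 + f 3 + f 4 + f 5 + f 6" for f :: "nat \<Rightarrow> complex"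
    by (simp add: eval_nat_numeral)
  have "mamu222 (i, j) (k, l) (m, n) = (\<Sum>r<7. u r (i, j) * v r (k, l) * w r (m, n))" for i j k l m n
    unfolding sum7 u_def v_def w_def mamu222_def
    by (cases i rule: two_exhaust; cases j rule: two_exhaust; cases k rule: two_exhaust;
        cases l rule: two_exhaust; cases m rule: two_exhaust; cases n rule: two_exhaust)
       simp_all
  then have "mamu222 x y z = (\<Sum>r<7. u r x * v r y * w r z)" for x y z
    by (cases x; cases y; cases z) simp
  then have "mamu222 = (\<lambda>x y z. \<Sum>r<7. u r x * v r y * w r z)" by blast
  then show ?thesis unfolding rank_le_def by blast
qed

lemma border_rank_ge_7:
  assumes "tsupport t = tsupport mamu222"
  shows "border_rank t \<ge> 7"
proof (rule ccontr)
  assume "\<not> ?thesis"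
  then have le: "border_rank t \<le> 6" by simp
  have "t \<in> zariski_closure {s. rank_le s 16}"
    by (rule subsetD[OF subset_zariski_closure]) (simp add: rank_le_16)
  then have "t \<in> zariski_closure {s. rank_le s (border_rank t)}"
    unfolding border_rank_def by (rule LeastI)
  moreover have "{s. rank_le s (border_rank t)} \<subseteq> {s. rank_le s 6}"
    by (intro Collect_mono impI rank_le_mono[OF _ le])
  ultimately have "t \<in> zariski_closure {s. rank_le s 6}"
    by (rule subsetD[OF zariski_closure_mono, rotated])
  then obtain F where "apolar t F" by (rule zariski_closure_apolar)
  then show False using not_apolar[OF assms] by blast
qed

theorem theorem2:
  shows "(\<forall>t. tsupport t = tsupport mamu222 \<longrightarrow> border_rank t \<ge> 7) \<and>
         (\<exists>t. tsupport t = tsupport mamu222 \<and> border_rank t = 7)"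
proof -
  have "mamu222 \<in> zariski_closure {s. rank_le s 7}"
    by (rule subsetD[OF subset_zariski_closure]) (simp add: rank_le_mamu222)
  then have "border_rank mamu222 \<le> 7" unfolding border_rank_def by (rule Least_le)
  then have "border_rank mamu222 = 7" using border_rank_ge_7[of mamu222] by simp
  then show ?thesis using border_rank_ge_7 by blast
qed

end
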